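(* If $(\mathbb{D},\Lambda^{\mathbb{D}})$ is a double category with cofolding, then the double categories $\mathbb{M}\mathrm{nd}(\mathbb{D})$ and $\mathbb{E}\mathrm{nd}(\mathbb{D})$ inherit cofoldings from $\mathbb{D}$, and the forgetful double functor $U\colon\mathbb{M}\mathrm{nd}(\mathbb{D})\to\mathbb{E}\mathrm{nd}(\mathbb{D})$ preserves them.
   Context: **Double categories.** Double categories are strict (internal categories in $\mathbf{Cat}$): objects, horizontal morphisms, vertical morphisms, squares. $[\alpha\ \beta]$ denotes horizontal composition ($\alpha$ on the left; $[f\ g]=g\circ f$), $\begin{bmatrix}\alpha\\ \beta\end{bmatrix}$ vertical composition ($\alpha$ on top); $1^h_C$ is the horizontal identity; $i^h_j$ is the horizontal identity square of a vertical morphism $j$, $i^v_f$ the vertical identity square of a horizontal morphism $f$. The horizontal 2-category $\mathbf{H}\mathbb{D}$ has the objects and horizontal morphisms of $\mathbb{D}$ and as 2-cells (top to bottom) the squares with identity vertical sides. **Cofolding.** For a 2-category $\mathbf{K}$, the double category of inverse quintets $\overline{\mathbb{Q}}\mathbf{K}$ has the objects and (as horizontal morphisms) morphisms of $\mathbf{K}$, vertical 1-category the opposite of the underlying 1-category of $\mathbf{K}$, and squares with top $f\colon A\to B$, bottom $g\colon C\to D$, left $j^{op}$ ($j\colon C\to A$), right $k^{op}$ ($k\colon D\to B$) the 2-cells $f\circ j\Rightarrow k\circ g$, composed by pasting. A cofolding on $\mathbb{D}$ is a double functor $\Lambda\colon\mathbb{D}\to\overline{\mathbb{Q}}\mathbf{H}\mathbb{D}$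 that is the identity on $\mathbf{H}\mathbb{D}$ and fully faithful (bijective for each fixed boundary) on squares: it sends each vertical $j\colon A\to C$ functorially to a horizontal $j^*\colon C\to A$ (the coholonomy) and gives bijections from squares with top $f$, bottom $g$, left $j$, right $k$ to 2-cells $\Lambda(\alpha)\colon[j^*\ f]\Rightarrow[g\ k^*]$. A double functor $F$ preserves (is compatible with) cofoldings if $F(j^* )=F(j)^*$ and $F(\Lambda(\alpha))=\Lambda(F(\alpha))$. **Endomorphisms and monads.** An endomorphism $(X,P)$ in $\mathbb{D}$ is an object $X$ with a horizontal morphism $P\colon X\to X$. A monad is an endomorphism with 2-cells $\mu_P\colon[P\ P]\Rightarrow P$, $\eta_P\colon1^h_X\Rightarrow P$ of $\mathbf{H}\mathbb{D}$ satisfying associativity and unit laws. A horizontal endomorphism map $(F,\phi)\colon(X,P)\to(Y,Q)$ is a horizontal morphism $F\colon X\to Y$ with a 2-cell $\phi\colon[F\ Q]\Rightarrow[P\ F]$. It is a horizontal monad map if $\begin{bmatrix}[i^v_F\ \eta_Q]\\ \phi\end{bmatrix}=[\eta_P\ i^v_F]$ and $\begin{bmatrix}[i^v_F\ \mu_Q]\\ \phi\end{bmatrix}=\begin{bmatrix}[\phi\ i^v_Q]\\ [i^v_P\ \phi]\\ [\mu_P\ i^v_F]\end{bmatrix}$. A vertical endomorphism map $(u,\bar u)\colon(X,P)\to(X',P')$ is a vertical morphism $u\colon X\to X'$ with a square $\bar u$ with top $P$, bottom $P'$, left and right $u$. It is a vertical monad map if $\begin{bmatrix}\eta_P\\ \bar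 u\end{bmatrix}=\begin{bmatrix}i^h_u\\ \eta_{P'}\end{bmatrix}$ and $\begin{bmatrix}\mu_P\\ \bar u\end{bmatrix}=\begin{bmatrix}[\bar u\ \bar u]\\ \mu_{P'}\end{bmatrix}$. An endomorphism (or monad) square with top $(F,\phi)$, bottom $(F',\phi')$, left $(u,\bar u)$, right $(v,\bar v)$ is a square $\alpha$ of $\mathbb{D}$ with top $F$, bottom $F'$, left $u$, right $v$ such that $\begin{bmatrix}\phi\\ [\bar u\ \alpha]\end{bmatrix}=\begin{bmatrix}[\alpha\ \bar v]\\ \phi'\end{bmatrix}$. These form double categories $\mathbb{E}\mathrm{nd}(\mathbb{D})$ and $\mathbb{M}\mathrm{nd}(\mathbb{D})$ with forgetful double functor $U$. **"Inherit".** The inherited cofoldings on $\mathbb{E}\mathrm{nd}(\mathbb{D})$ and $\mathbb{M}\mathrm{nd}(\mathbb{D})$ are those with coholonomy $(u,\bar u)^*=(u^*,\Lambda^{\mathbb{D}}(\bar u))\colon(X',P')\to(X,P)$ and, on squares, $\alpha\mapsto\Lambda^{\mathbb{D}}(\alpha)$. *)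

theory Defs
  imports Main
begin

text \<open>
  Every composition below is written in diagrammatic order: \<open>Comp C f g\<close> is ``first \<open>f\<close>, then \<open>g\<close>''.
  Operations are total HOL functions; the axioms constrain them only on the carrier sets and only
  for composable arguments.
\<close>

section \<open>Categories and functors\<close>

record ('o, 'a) cat =
  Objs :: "'o set"
  Arrs :: "'a set"
  Dom  :: "'a \<Rightarrow> 'o"
  Cod  :: "'a \<Rightarrow> 'o"
  Idt  :: "'o \<Rightarrow> 'a"
  Comp :: "'a \<Rightarrow> 'a \<Rightarrow> 'a"

definition category :: "('o, 'a) cat \<Rightarrow> bool" where
  "category C \<longleftrightarrow>
     (\<forall>f\<in>Arrs C. Dom C f \<in> Objs C \<and> Cod C f \<in> Objs C) \<and>
     (\<forall>A\<in>Objs C. Idt C A \<in> Arrs C \<and> Dom C (Idt C A) = A \<and> Cod C (Idt C A) = A) \<and>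
     (\<forall>f\<in>Arrs C. \<forall>g\<in>Arrs C. Cod C f = Dom C g \<longrightarrow>
        Comp C f g \<in> Arrs C \<and> Dom C (Comp C f g) = Dom C f \<and> Cod C (Comp C f g) = Cod C g) \<and>
     (\<forall>f\<in>Arrs C. Comp C (Idt C (Dom C f)) f = f \<and> Comp C f (Idt C (Cod C f)) = f) \<and>
     (\<forall>f\<in>Arrs C. \<forall>g\<in>Arrs C. \<forall>h\<in>Arrs C. Cod C f = Dom C g \<longrightarrow> Cod C g = Dom C h \<longrightarrow>
        Comp C (Comp C f g) h = Comp C f (Comp C g h))"

definition functor_between ::
  "('o, 'a) cat \<Rightarrow> ('p, 'b) cat \<Rightarrow> ('o \<Rightarrow> 'p) \<Rightarrow> ('a \<Rightarrow> 'b) \<Rightarrow> bool" where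
  "functor_between C D Fo Fa \<longleftrightarrow>
     category C \<and> category D \<and>
     (\<forall>A\<in>Objs C. Fo A \<in> Objs D) \<and>
     (\<forall>f\<in>Arrs C. Fa f \<in> Arrs D \<and> Dom D (Fa f) = Fo (Dom C f) \<and> Cod D (Fa f) = Fo (Cod C f)) \<and>
     (\<forall>A\<in>Objs C. Fa (Idt C A) = Idt D (Fo A)) \<and>
     (\<forall>f\<in>Arrs C. \<forall>g\<in>Arrs C. Cod C f = Dom C g \<longrightarrow> Fa (Comp C f g) = Comp D (Fa f) (Fa g))"

section \<open>Double categories and double functors\<close>

record ('o, 'h, 'v, 's) dblcat =
  Obj  :: "'o set"
  Hor  :: "'h set"
  Ver  :: "'v set"
  Sqr  :: "'s set"
  hdom :: "'h \<Rightarrow> 'o"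
  hcod :: "'h \<Rightarrow> 'o"
  hid  :: "'o \<Rightarrow> 'h"
  hcmp :: "'h \<Rightarrow> 'h \<Rightarrow> 'h"
  vdom :: "'v \<Rightarrow> 'o"
  vcod :: "'v \<Rightarrow> 'o"
  vid  :: "'o \<Rightarrow> 'v"
  vcmp :: "'v \<Rightarrow> 'v \<Rightarrow> 'v"
  stop :: "'s \<Rightarrow> 'h"
  sbot :: "'s \<Rightarrow> 'h"
  slft :: "'s \<Rightarrow> 'v"
  srgt :: "'s \<Rightarrow> 'v"
  ih   :: "'v \<Rightarrow> 's"
  shc  :: "'s \<Rightarrow> 's \<Rightarrow> 's"
  iv   :: "'h \<Rightarrow> 's"
  svc  :: "'s \<Rightarrow> 's \<Rightarrow> 's"

text \<open>
  \<open>shc D \<alpha> \<beta>\<close> is the horizontal composite with \<open>\<alpha>\<close> on the left, \<open>svc D \<alpha> \<beta>\<close> the vertical composite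
  with \<open>\<alpha>\<close> on top; \<open>ih D j\<close> is the horizontal identity square of the vertical morphism \<open>j\<close> and
  \<open>iv D f\<close> the vertical identity square of the horizontal morphism \<open>f\<close>.
\<close>

definition hor_cat :: "('o, 'h, 'v, 's) dblcat \<Rightarrow> ('o, 'h) cat" where
  "hor_cat D = \<lparr>Objs = Obj D, Arrs = Hor D, Dom = hdom D, Cod = hcod D, Idt = hid D, Comp = hcmp D\<rparr>"

definition ver_cat :: "('o, 'h, 'v, 's) dblcat \<Rightarrow> ('o, 'v) cat" where
  "ver_cat D = \<lparr>Objs = Obj D, Arrs = Ver D, Dom = vdom D, Cod = vcod D, Idt = vid D, Comp = vcmp D\<rparr>"

definition sqr_hcat :: "('o, 'h, 'v, 's) dblcat \<Rightarrow> ('v, 's) cat" where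
  "sqr_hcat D = \<lparr>Objs = Ver D, Arrs = Sqr D, Dom = slft D, Cod = srgt D, Idt = ih D, Comp = shc D\<rparr>"

definition sqr_vcat :: "('o, 'h, 'v, 's) dblcat \<Rightarrow> ('h, 's) cat" where
  "sqr_vcat D = \<lparr>Objs = Hor D, Arrs = Sqr D, Dom = stop D, Cod = sbot D, Idt = iv D, Comp = svc D\<rparr>"

text \<open>
  An internal category in the category of categories, written out symmetrically: the six functors
  are source, target and unit for each of the two directions, and functoriality of horizontal
  composition amounts to the functoriality of \<open>stop\<close>, \<open>sbot\<close> and \<open>iv\<close> together with interchange.
\<close>

definition double_category :: "('o, 'h, 'v, 's) dblcat \<Rightarrow> bool" where
  "double_category D \<longleftrightarrow>
     functor_between (sqr_vcat D) (ver_cat D) (hdom D) (slft D) \<and>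
     functor_between (sqr_vcat D) (ver_cat D) (hcod D) (srgt D) \<and>
     functor_between (ver_cat D) (sqr_vcat D) (hid D) (ih D) \<and>
     functor_between (sqr_hcat D) (hor_cat D) (vdom D) (stop D) \<and>
     functor_between (sqr_hcat D) (hor_cat D) (vcod D) (sbot D) \<and>
     functor_between (hor_cat D) (sqr_hcat D) (vid D) (iv D) \<and>
     (\<forall>\<alpha>\<in>Sqr D. \<forall>\<beta>\<in>Sqr D. \<forall>\<gamma>\<in>Sqr D. \<forall>\<delta>\<in>Sqr D.
        srgt D \<alpha> = slft D \<beta> \<longrightarrow> srgt D \<gamma> = slft D \<delta> \<longrightarrow>
        sbot D \<alpha> = stop D \<gamma> \<longrightarrow> sbot D \<beta> = stop D \<delta> \<longrightarrow>
        svc D (shc D \<alpha> \<beta>) (shc D \<gamma> \<delta>) = shc D (svc D \<alpha> \<gamma>) (svc D \<beta> \<delta>))"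

definition boundary :: "('o, 'h, 'v, 's) dblcat \<Rightarrow> 'h \<Rightarrow> 'h \<Rightarrow> 'v \<Rightarrow> 'v \<Rightarrow> bool" where
  "boundary D f g j k \<longleftrightarrow>
     f \<in> Hor D \<and> g \<in> Hor D \<and> j \<in> Ver D \<and> k \<in> Ver D \<and>
     hdom D f = vdom D j \<and> hcod D f = vdom D k \<and> hdom D g = vcod D j \<and> hcod D g = vcod D k"

definition squares :: "('o, 'h, 'v, 's) dblcat \<Rightarrow> 'h \<Rightarrow> 'h \<Rightarrow> 'v \<Rightarrow> 'v \<Rightarrow> 's set" where
  "squares D f g j k =
     {\<alpha>\<in>Sqr D. stop D \<alpha> = f \<and> sbot D \<alpha> = g \<and> slft D \<alpha> = j \<and> srgt D \<alpha> = k}"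

record ('o, 'h, 'v, 's, 'o1, 'h1, 'v1, 's1) dblfun =
  Fobj :: "'o \<Rightarrow> 'o1"
  Fhor :: "'h \<Rightarrow> 'h1"
  Fver :: "'v \<Rightarrow> 'v1"
  Fsqr :: "'s \<Rightarrow> 's1"

definition double_functor ::
  "('o, 'h, 'v, 's) dblcat \<Rightarrow> ('o1, 'h1, 'v1, 's1) dblcat \<Rightarrow>
   ('o, 'h, 'v, 's, 'o1, 'h1, 'v1, 's1) dblfun \<Rightarrow> bool" where
  "double_functor C D F \<longleftrightarrow>
     double_category C \<and> double_category D \<and>
     functor_between (hor_cat C) (hor_cat D) (Fobj F) (Fhor F) \<and>
     functor_between (ver_cat C) (ver_cat D) (Fobj F) (Fver F) \<and>
     functor_between (sqr_hcat C) (sqr_hcat D) (Fver F) (Fsqr F) \<and>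
     functor_between (sqr_vcat C) (sqr_vcat D) (Fhor F) (Fsqr F)"

definition fully_faithful_on_squares ::
  "('o, 'h, 'v, 's) dblcat \<Rightarrow> ('o1, 'h1, 'v1, 's1) dblcat \<Rightarrow>
   ('o, 'h, 'v, 's, 'o1, 'h1, 'v1, 's1) dblfun \<Rightarrow> bool" where
  "fully_faithful_on_squares C D F \<longleftrightarrow>
     (\<forall>f g j k. boundary C f g j k \<longrightarrow>
        bij_betw (Fsqr F) (squares C f g j k)
          (squares D (Fhor F f) (Fhor F g) (Fver F j) (Fver F k)))"

section \<open>Strict 2-categories, inverse quintets, cofoldings\<close>

record ('o, 'm, 'c) twocat =
  Cell0 :: "'o set"
  Cell1 :: "'m set"
  Cell2 :: "'c set"
  dom1  :: "'m \<Rightarrow> 'o"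
  cod1  :: "'m \<Rightarrow> 'o"
  id1   :: "'o \<Rightarrow> 'm"
  cmp1  :: "'m \<Rightarrow> 'm \<Rightarrow> 'm"
  dom2  :: "'c \<Rightarrow> 'm"
  cod2  :: "'c \<Rightarrow> 'm"
  id2   :: "'m \<Rightarrow> 'c"
  vc2   :: "'c \<Rightarrow> 'c \<Rightarrow> 'c"
  hc2   :: "'c \<Rightarrow> 'c \<Rightarrow> 'c"

definition cell1_cat :: "('o, 'm, 'c) twocat \<Rightarrow> ('o, 'm) cat" where
  "cell1_cat K =
     \<lparr>Objs = Cell0 K, Arrs = Cell1 K, Dom = dom1 K, Cod = cod1 K, Idt = id1 K, Comp = cmp1 K\<rparr>"

definition cell2_vcat :: "('o, 'm, 'c) twocat \<Rightarrow> ('m, 'c) cat" where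
  "cell2_vcat K =
     \<lparr>Objs = Cell1 K, Arrs = Cell2 K, Dom = dom2 K, Cod = cod2 K, Idt = id2 K, Comp = vc2 K\<rparr>"

definition cell2_hcat :: "('o, 'm, 'c) twocat \<Rightarrow> ('o, 'c) cat" where
  "cell2_hcat K =
     \<lparr>Objs = Cell0 K, Arrs = Cell2 K, Dom = (\<lambda>\<alpha>. dom1 K (dom2 K \<alpha>)), Cod = (\<lambda>\<alpha>. cod1 K (dom2 K \<alpha>)),
      Idt = (\<lambda>A. id2 K (id1 K A)), Comp = hc2 K\<rparr>"

definition two_category :: "('o, 'm, 'c) twocat \<Rightarrow> bool" where
  "two_category K \<longleftrightarrow>
     category (cell2_vcat K) \<and>
     functor_between (cell2_hcat K) (cell1_cat K) (\<lambda>A. A) (dom2 K) \<and>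
     functor_between (cell2_hcat K) (cell1_cat K) (\<lambda>A. A) (cod2 K) \<and>
     functor_between (cell1_cat K) (cell2_hcat K) (\<lambda>A. A) (id2 K) \<and>
     (\<forall>\<alpha>\<in>Cell2 K. \<forall>\<beta>\<in>Cell2 K. \<forall>\<gamma>\<in>Cell2 K. \<forall>\<delta>\<in>Cell2 K.
        cod2 K \<alpha> = dom2 K \<gamma> \<longrightarrow> cod2 K \<beta> = dom2 K \<delta> \<longrightarrow>
        cod1 K (dom2 K \<alpha>) = dom1 K (dom2 K \<beta>) \<longrightarrow>
        vc2 K (hc2 K \<alpha> \<beta>) (hc2 K \<gamma> \<delta>) = hc2 K (vc2 K \<alpha> \<gamma>) (vc2 K \<beta> \<delta>))"

definition horizontal_2cat :: "('o, 'h, 'v, 's) dblcat \<Rightarrow> ('o, 'h, 's) twocat" where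
  "horizontal_2cat D =
     \<lparr>Cell0 = Obj D, Cell1 = Hor D,
      Cell2 = {\<alpha>\<in>Sqr D. slft D \<alpha> = vid D (hdom D (stop D \<alpha>)) \<and> srgt D \<alpha> = vid D (hcod D (stop D \<alpha>))},
      dom1 = hdom D, cod1 = hcod D, id1 = hid D, cmp1 = hcmp D,
      dom2 = stop D, cod2 = sbot D, id2 = iv D, vc2 = svc D, hc2 = shc D\<rparr>"

text \<open>
  A cell together with its four sides. In the inverse quintets, and in the double categories of
  endomorphisms and monads below, the sides are not determined by the underlying cell.
\<close>

datatype ('x, 'y, 'c) framed =
  Framed (ftop: 'x) (fbot: 'x) (flft: 'y) (frgt: 'y) (fcell: 'c)

text \<open>
  A vertical morphism \<open>A \<rightarrow> C\<close> of the inverse quintets is a 1-cell \<open>j : C \<rightarrow> A\<close>. In a square with top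
  \<open>f : A \<rightarrow> B\<close>, bottom \<open>g : C \<rightarrow> D\<close>, left \<open>j : C \<rightarrow> A\<close> and right \<open>k : D \<rightarrow> B\<close>, the 2-cell goes from
  \<open>f \<circ> j = cmp1 K j f\<close> to \<open>k \<circ> g = cmp1 K g k\<close>. With \<open>\<cdot>\<close> for \<open>cmp1\<close> and whiskering, the pastings are
  \<open>j \<cdot> f \<cdot> f' \<Rightarrow> g \<cdot> k \<cdot> f' \<Rightarrow> g \<cdot> g' \<cdot> k'\<close> (horizontal) and
  \<open>j' \<cdot> j \<cdot> f \<Rightarrow> j' \<cdot> g \<cdot> k \<Rightarrow> g' \<cdot> k' \<cdot> k\<close> (vertical).
\<close>

definition inverse_quintets ::
  "('o, 'm, 'c) twocat \<Rightarrow> ('o, 'm, 'm, ('m, 'm, 'c) framed) dblcat" where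
  "inverse_quintets K =
     \<lparr>Obj = Cell0 K, Hor = Cell1 K, Ver = Cell1 K,
      Sqr = {Framed f g j k \<alpha> | f g j k \<alpha>.
               f \<in> Cell1 K \<and> g \<in> Cell1 K \<and> j \<in> Cell1 K \<and> k \<in> Cell1 K \<and>
               cod1 K j = dom1 K f \<and> dom1 K j = dom1 K g \<and>
               cod1 K k = cod1 K f \<and> dom1 K k = cod1 K g \<and>
               \<alpha> \<in> Cell2 K \<and> dom2 K \<alpha> = cmp1 K j f \<and> cod2 K \<alpha> = cmp1 K g k},
      hdom = dom1 K, hcod = cod1 K, hid = id1 K, hcmp = cmp1 K,
      vdom = cod1 K, vcod = dom1 K, vid = id1 K, vcmp = (\<lambda>j j'. cmp1 K j' j),
      stop = ftop, sbot = fbot, slft = flft, srgt = frgt,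
      ih = (\<lambda>j. Framed (id1 K (cod1 K j)) (id1 K (dom1 K j)) j j (id2 K j)),
      shc = (\<lambda>s s'. Framed (cmp1 K (ftop s) (ftop s')) (cmp1 K (fbot s) (fbot s')) (flft s) (frgt s')
               (vc2 K (hc2 K (fcell s) (id2 K (ftop s'))) (hc2 K (id2 K (fbot s)) (fcell s')))),
      iv = (\<lambda>f. Framed f f (id1 K (dom1 K f)) (id1 K (cod1 K f)) (id2 K f)),
      svc = (\<lambda>s s'. Framed (ftop s) (fbot s') (cmp1 K (flft s') (flft s)) (cmp1 K (frgt s') (frgt s))
               (vc2 K (hc2 K (id2 K (flft s')) (fcell s)) (hc2 K (fcell s') (id2 K (frgt s)))))\<rparr>"

type_synonym ('o, 'h, 'v, 's) cofolding_data =
  "('o, 'h, 'v, 's, 'o, 'h, 'h, ('h, 'h, 's) framed) dblfun"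

abbreviation coholonomy :: "('o, 'h, 'v, 's) cofolding_data \<Rightarrow> 'v \<Rightarrow> 'h" where
  "coholonomy \<Lambda> j \<equiv> Fver \<Lambda> j"

abbreviation cof_cell :: "('o, 'h, 'v, 's) cofolding_data \<Rightarrow> 's \<Rightarrow> 's" where
  "cof_cell \<Lambda> \<alpha> \<equiv> fcell (Fsqr \<Lambda> \<alpha>)"

text \<open>For a 2-cell \<open>\<alpha>\<close> of the horizontal 2-category, functoriality forces the sides of \<open>Fsqr \<Lambda> \<alpha>\<close> to be
  those of \<open>\<alpha>\<close> and identities, so only the underlying cell has to be prescribed.\<close>

definition cofolding :: "('o, 'h, 'v, 's) dblcat \<Rightarrow> ('o, 'h, 'v, 's) cofolding_data \<Rightarrow> bool" where
  "cofolding D \<Lambda> \<longleftrightarrow>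
     double_functor D (inverse_quintets (horizontal_2cat D)) \<Lambda> \<and>
     (\<forall>A\<in>Obj D. Fobj \<Lambda> A = A) \<and>
     (\<forall>f\<in>Hor D. Fhor \<Lambda> f = f) \<and>
     (\<forall>\<alpha>\<in>Cell2 (horizontal_2cat D). cof_cell \<Lambda> \<alpha> = \<alpha>) \<and>
     fully_faithful_on_squares D (inverse_quintets (horizontal_2cat D)) \<Lambda>"

definition preserves_cofoldings ::
  "('o, 'h, 'v, 's) dblcat \<Rightarrow> ('o, 'h, 'v, 's) cofolding_data \<Rightarrow>
   ('o1, 'h1, 'v1, 's1) dblcat \<Rightarrow> ('o1, 'h1, 'v1, 's1) cofolding_data \<Rightarrow>
   ('o, 'h, 'v, 's, 'o1, 'h1, 'v1, 's1) dblfun \<Rightarrow> bool" where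
  "preserves_cofoldings C \<Lambda> C' \<Lambda>' F \<longleftrightarrow>
     double_functor C C' F \<and>
     (\<forall>j\<in>Ver C. Fhor F (coholonomy \<Lambda> j) = coholonomy \<Lambda>' (Fver F j)) \<and>
     (\<forall>\<alpha>\<in>Sqr C. Fsqr F (cof_cell \<Lambda> \<alpha>) = cof_cell \<Lambda>' (Fsqr F \<alpha>))"

section \<open>Endomorphisms and monads\<close>

definition two_cell :: "('o, 'h, 'v, 's) dblcat \<Rightarrow> 's \<Rightarrow> 'h \<Rightarrow> 'h \<Rightarrow> bool" where
  "two_cell D \<alpha> f g \<longleftrightarrow> \<alpha> \<in> Cell2 (horizontal_2cat D) \<and> stop D \<alpha> = f \<and> sbot D \<alpha> = g"

record ('o, 'h) endo =
  base  :: 'o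
  emor  :: 'h

record ('o, 'h, 's) monad = "('o, 'h) endo" +
  mult  :: 's
  unit_cell :: 's

text \<open>
  Maps carry their source and target, since these are not determined by the underlying data
  \<open>(F, \<phi>)\<close> and \<open>(u, u')\<close>. The type \<open>'e\<close> of sources and targets is that of endomorphisms or that of
  monads; the notions for endomorphisms apply to monads by record subtyping.
\<close>

datatype ('e, 'h, 's) hmap = HMap (hsrc: 'e) (htgt: 'e) (hmor: 'h) (hcell: 's)

datatype ('e, 'v, 's) vmap = VMap (vsrc: 'e) (vtgt: 'e) (vmor: 'v) (vsqr: 's)

definition endomorphism :: "('o, 'h, 'v, 's) dblcat \<Rightarrow> ('o, 'h, 'z) endo_scheme \<Rightarrow> bool" where
  "endomorphism D E \<longleftrightarrow>
     base E \<in> Obj D \<and> emor E \<in> Hor D \<and> hdom D (emor E) = base E \<and> hcod D (emor E) = base E"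

definition is_monad :: "('o, 'h, 'v, 's) dblcat \<Rightarrow> ('o, 'h, 's) monad \<Rightarrow> bool" where
  "is_monad D M \<longleftrightarrow>
     endomorphism D M \<and>
     (let P = emor M; \<mu> = mult M; \<eta> = unit_cell M in
        two_cell D \<mu> (hcmp D P P) P \<and>
        two_cell D \<eta> (hid D (base M)) P \<and>
        svc D (shc D \<mu> (iv D P)) \<mu> = svc D (shc D (iv D P) \<mu>) \<mu> \<and>
        svc D (shc D \<eta> (iv D P)) \<mu> = iv D P \<and>
        svc D (shc D (iv D P) \<eta>) \<mu> = iv D P)"

definition endo_hmap ::
  "('o, 'h, 'v, 's) dblcat \<Rightarrow> (('o, 'h, 'z) endo_scheme, 'h, 's) hmap \<Rightarrow> bool" where
  "endo_hmap D m \<longleftrightarrow>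
     endomorphism D (hsrc m) \<and> endomorphism D (htgt m) \<and>
     hmor m \<in> Hor D \<and> hdom D (hmor m) = base (hsrc m) \<and> hcod D (hmor m) = base (htgt m) \<and>
     two_cell D (hcell m) (hcmp D (hmor m) (emor (htgt m))) (hcmp D (emor (hsrc m)) (hmor m))"

definition endo_vmap ::
  "('o, 'h, 'v, 's) dblcat \<Rightarrow> (('o, 'h, 'z) endo_scheme, 'v, 's) vmap \<Rightarrow> bool" where
  "endo_vmap D m \<longleftrightarrow>
     endomorphism D (vsrc m) \<and> endomorphism D (vtgt m) \<and>
     vmor m \<in> Ver D \<and> vdom D (vmor m) = base (vsrc m) \<and> vcod D (vmor m) = base (vtgt m) \<and>
     vsqr m \<in> squares D (emor (vsrc m)) (emor (vtgt m)) (vmor m) (vmor m)"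

definition monad_hmap ::
  "('o, 'h, 'v, 's) dblcat \<Rightarrow> (('o, 'h, 's) monad, 'h, 's) hmap \<Rightarrow> bool" where
  "monad_hmap D m \<longleftrightarrow>
     is_monad D (hsrc m) \<and> is_monad D (htgt m) \<and> endo_hmap D m \<and>
     (let P = emor (hsrc m); Q = emor (htgt m); F = hmor m; \<phi> = hcell m in
        svc D (shc D (iv D F) (unit_cell (htgt m))) \<phi> = shc D (unit_cell (hsrc m)) (iv D F) \<and>
        svc D (shc D (iv D F) (mult (htgt m))) \<phi> =
          svc D (svc D (shc D \<phi> (iv D Q)) (shc D (iv D P) \<phi>)) (shc D (mult (hsrc m)) (iv D F)))"

definition monad_vmap ::
  "('o, 'h, 'v, 's) dblcat \<Rightarrow> (('o, 'h, 's) monad, 'v, 's) vmap \<Rightarrow> bool" where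
  "monad_vmap D m \<longleftrightarrow>
     is_monad D (vsrc m) \<and> is_monad D (vtgt m) \<and> endo_vmap D m \<and>
     svc D (unit_cell (vsrc m)) (vsqr m) = svc D (ih D (vmor m)) (unit_cell (vtgt m)) \<and>
     svc D (mult (vsrc m)) (vsqr m) = svc D (shc D (vsqr m) (vsqr m)) (mult (vtgt m))"

type_synonym ('e, 'h, 'v, 's) esquare = "(('e, 'h, 's) hmap, ('e, 'v, 's) vmap, 's) framed"

definition endo_square ::
  "('o, 'h, 'v, 's) dblcat \<Rightarrow> (('o, 'h, 'z) endo_scheme, 'h, 'v, 's) esquare \<Rightarrow> bool" where
  "endo_square D s \<longleftrightarrow>
     hsrc (ftop s) = vsrc (flft s) \<and> htgt (ftop s) = vsrc (frgt s) \<and>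
     hsrc (fbot s) = vtgt (flft s) \<and> htgt (fbot s) = vtgt (frgt s) \<and>
     fcell s \<in> squares D (hmor (ftop s)) (hmor (fbot s)) (vmor (flft s)) (vmor (frgt s)) \<and>
     svc D (hcell (ftop s)) (shc D (vsqr (flft s)) (fcell s)) =
       svc D (shc D (fcell s) (vsqr (frgt s))) (hcell (fbot s))"

definition hmap_id ::
  "('o, 'h, 'v, 's) dblcat \<Rightarrow> ('o, 'h, 'z) endo_scheme \<Rightarrow> (('o, 'h, 'z) endo_scheme, 'h, 's) hmap" where
  "hmap_id D E = HMap E E (hid D (base E)) (iv D (emor E))"

text \<open>The cell of the composite of \<open>(F, \<phi>) : (X, P) \<rightarrow> (Y, Q)\<close> and \<open>(G, \<psi>) : (Y, Q) \<rightarrow> (Z, R)\<close> is the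
  pasting \<open>[F G R] \<Rightarrow> [F Q G] \<Rightarrow> [P F G]\<close>.\<close>

definition hmap_comp ::
  "('o, 'h, 'v, 's) dblcat \<Rightarrow> ('e, 'h, 's) hmap \<Rightarrow> ('e, 'h, 's) hmap \<Rightarrow> ('e, 'h, 's) hmap" where
  "hmap_comp D m n =
     HMap (hsrc m) (htgt n) (hcmp D (hmor m) (hmor n))
       (svc D (shc D (iv D (hmor m)) (hcell n)) (shc D (hcell m) (iv D (hmor n))))"

definition vmap_id ::
  "('o, 'h, 'v, 's) dblcat \<Rightarrow> ('o, 'h, 'z) endo_scheme \<Rightarrow> (('o, 'h, 'z) endo_scheme, 'v, 's) vmap" where
  "vmap_id D E = VMap E E (vid D (base E)) (iv D (emor E))"

definition vmap_comp ::
  "('o, 'h, 'v, 's) dblcat \<Rightarrow> ('e, 'v, 's) vmap \<Rightarrow> ('e, 'v, 's) vmap \<Rightarrow> ('e, 'v, 's) vmap" where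
  "vmap_comp D m n =
     VMap (vsrc m) (vtgt n) (vcmp D (vmor m) (vmor n)) (svc D (vsqr m) (vsqr n))"

text \<open>The double category with prescribed objects, horizontal and vertical maps and with all
  endomorphism squares between them.\<close>

definition endo_dblcat ::
  "('o, 'h, 'v, 's) dblcat \<Rightarrow> ('o, 'h, 'z) endo_scheme set \<Rightarrow>
   (('o, 'h, 'z) endo_scheme, 'h, 's) hmap set \<Rightarrow> (('o, 'h, 'z) endo_scheme, 'v, 's) vmap set \<Rightarrow>
   (('o, 'h, 'z) endo_scheme, (('o, 'h, 'z) endo_scheme, 'h, 's) hmap,
    (('o, 'h, 'z) endo_scheme, 'v, 's) vmap, (('o, 'h, 'z) endo_scheme, 'h, 'v, 's) esquare) dblcat" where
  "endo_dblcat D Es Hs Vs =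
     \<lparr>Obj = Es, Hor = Hs, Ver = Vs,
      Sqr = {s. ftop s \<in> Hs \<and> fbot s \<in> Hs \<and> flft s \<in> Vs \<and> frgt s \<in> Vs \<and> endo_square D s},
      hdom = hsrc, hcod = htgt, hid = hmap_id D, hcmp = hmap_comp D,
      vdom = vsrc, vcod = vtgt, vid = vmap_id D, vcmp = vmap_comp D,
      stop = ftop, sbot = fbot, slft = flft, srgt = frgt,
      ih = (\<lambda>m. Framed (hmap_id D (vsrc m)) (hmap_id D (vtgt m)) m m (ih D (vmor m))),
      shc = (\<lambda>s s'. Framed (hmap_comp D (ftop s) (ftop s')) (hmap_comp D (fbot s) (fbot s'))
               (flft s) (frgt s') (shc D (fcell s) (fcell s'))),
      iv = (\<lambda>m. Framed m m (vmap_id D (hsrc m)) (vmap_id D (htgt m)) (iv D (hmor m))),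
      svc = (\<lambda>s s'. Framed (ftop s) (fbot s') (vmap_comp D (flft s) (flft s'))
               (vmap_comp D (frgt s) (frgt s')) (svc D (fcell s) (fcell s')))\<rparr>"

definition End ::
  "('o, 'h, 'v, 's) dblcat \<Rightarrow>
   (('o, 'h) endo, (('o, 'h) endo, 'h, 's) hmap, (('o, 'h) endo, 'v, 's) vmap,
    (('o, 'h) endo, 'h, 'v, 's) esquare) dblcat" where
  "End D = endo_dblcat D {E. endomorphism D E} {m. endo_hmap D m} {m. endo_vmap D m}"

definition Mnd ::
  "('o, 'h, 'v, 's) dblcat \<Rightarrow>
   (('o, 'h, 's) monad, (('o, 'h, 's) monad, 'h, 's) hmap, (('o, 'h, 's) monad, 'v, 's) vmap,
    (('o, 'h, 's) monad, 'h, 'v, 's) esquare) dblcat" where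
  "Mnd D = endo_dblcat D {M. is_monad D M} {m. monad_hmap D m} {m. monad_vmap D m}"

definition forget_hmap :: "(('o, 'h, 's) monad, 'h, 's) hmap \<Rightarrow> (('o, 'h) endo, 'h, 's) hmap" where
  "forget_hmap m = HMap (endo.truncate (hsrc m)) (endo.truncate (htgt m)) (hmor m) (hcell m)"

definition forget_vmap :: "(('o, 'h, 's) monad, 'v, 's) vmap \<Rightarrow> (('o, 'h) endo, 'v, 's) vmap" where
  "forget_vmap m = VMap (endo.truncate (vsrc m)) (endo.truncate (vtgt m)) (vmor m) (vsqr m)"

definition forgetful ::
  "(('o, 'h, 's) monad, (('o, 'h, 's) monad, 'h, 's) hmap, (('o, 'h, 's) monad, 'v, 's) vmap,
    (('o, 'h, 's) monad, 'h, 'v, 's) esquare,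
    ('o, 'h) endo, (('o, 'h) endo, 'h, 's) hmap, (('o, 'h) endo, 'v, 's) vmap,
    (('o, 'h) endo, 'h, 'v, 's) esquare) dblfun" where
  "forgetful =
     \<lparr>Fobj = endo.truncate, Fhor = forget_hmap, Fver = forget_vmap,
      Fsqr = (\<lambda>s. Framed (forget_hmap (ftop s)) (forget_hmap (fbot s))
                (forget_vmap (flft s)) (forget_vmap (frgt s)) (fcell s))\<rparr>"

section \<open>Inherited cofoldings\<close>

text \<open>\<open>(u, u')\<^sup>* = (u\<^sup>*, \<Lambda> u')\<close>, from the target of \<open>(u, u')\<close> to its source.\<close>

definition inherited_coholonomy ::
  "('o, 'h, 'v, 's) cofolding_data \<Rightarrow> ('e, 'v, 's) vmap \<Rightarrow> ('e, 'h, 's) hmap" where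
  "inherited_coholonomy \<Lambda> m =
     HMap (vtgt m) (vsrc m) (coholonomy \<Lambda> (vmor m)) (cof_cell \<Lambda> (vsqr m))"

text \<open>A square \<open>\<alpha>\<close> with top \<open>t\<close>, bottom \<open>b\<close>, left \<open>l\<close> and right \<open>r\<close> goes to the 2-cell
  \<open>[l\<^sup>* t] \<Rightarrow> [b r\<^sup>*]\<close> with underlying square \<open>\<Lambda> \<alpha>\<close>.\<close>

definition inherited_cofolding ::
  "('o, 'h, 'v, 's) dblcat \<Rightarrow> ('o, 'h, 'v, 's) cofolding_data \<Rightarrow>
   (('o, 'h, 'z) endo_scheme, (('o, 'h, 'z) endo_scheme, 'h, 's) hmap,
    (('o, 'h, 'z) endo_scheme, 'v, 's) vmap,
    (('o, 'h, 'z) endo_scheme, 'h, 'v, 's) esquare) cofolding_data" where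
  "inherited_cofolding D \<Lambda> =
     \<lparr>Fobj = (\<lambda>E. E), Fhor = (\<lambda>m. m), Fver = inherited_coholonomy \<Lambda>,
      Fsqr = (\<lambda>s.
        let l = inherited_coholonomy \<Lambda> (flft s); r = inherited_coholonomy \<Lambda> (frgt s) in
        Framed (ftop s) (fbot s) l r
          (Framed (hmap_comp D l (ftop s)) (hmap_comp D (fbot s) r)
             (vmap_id D (hsrc (fbot s))) (vmap_id D (htgt (ftop s)))
             (cof_cell \<Lambda> (fcell s))))\<rparr>"

end

theory Submission
  imports Defs
begin

text \<open>
  The inherited cofolding does nothing to a square but apply \<open>\<Lambda>\<close> to its underlying square in \<open>D\<close>. Since
  \<open>\<Lambda>\<close> takes vertical and horizontal composites of squares to pastings of whiskered 2-cells, and is the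
  identity on 2-cells, applying it to the equations of a vertical monad map \<open>(u, u')\<close> gives those of a
  horizontal monad map \<open>(u\<^sup>*, \<Lambda> u')\<close>, and applying it to the equation of an endomorphism square gives
  the equation of a 2-cell \<open>[l\<^sup>* t] \<Rightarrow> [b r\<^sup>*]\<close>. As \<open>\<Lambda>\<close> is bijective on squares with a fixed boundary, the
  latter two equations are equivalent, which is full faithfulness. Nothing depends on whether the maps
  are those of endomorphisms or of monads, provided that they are closed under identities, composition
  and coholonomy.
\<close>

section \<open>2-categories and inverse quintets\<close>

text \<open>\<open>double_functor\<close> demands that both of its ends be double categories. The
  inverse quintets over the horizontal 2-category of endomorphisms, or of monads, must therefore be
  shown lawful before their cofolding can be stated as a fact. This is why quintets are treated over
  an arbitrary 2-category, and horizontal 2-categories over an arbitrary double category. Equations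
  between pastings of 2-cells are settled by a normal form, which leaves one thing undecided: the
  order of two cells that act on disjoint factors of a composite. That order matters in two places,
  the interchange law of quintets and the multiplication law for a composite of horizontal monad
  maps. Squares with arbitrary vertical sides cannot be whiskered by horizontal morphisms. For them,
  identity squares are inserted until the interchange law of the double category applies.\<close>

locale two_cat =
  fixes K :: "('o, 'm, 'c) twocat"
  assumes two_category: "two_category K"
begin

text \<open>The unit laws take the object as a variable tied down by an equation. A left-hand side
  containing \<open>dom1 K f\<close> would stop matching once that domain has been rewritten to
  another name of the same object.\<close>

lemma cell1:
  "f \<in> Cell1 K \<Longrightarrow> dom1 K f \<in> Cell0 K"
  "f \<in> Cell1 K \<Longrightarrow> cod1 K f \<in> Cell0 K"
  "A \<in> Cell0 K \<Longrightarrow> id1 K A \<in> Cell1 K"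
  "A \<in> Cell0 K \<Longrightarrow> dom1 K (id1 K A) = A"
  "A \<in> Cell0 K \<Longrightarrow> cod1 K (id1 K A) = A"
  "\<lbrakk>f \<in> Cell1 K; g \<in> Cell1 K; cod1 K f = dom1 K g\<rbrakk> \<Longrightarrow> cmp1 K f g \<in> Cell1 K"
  "\<lbrakk>f \<in> Cell1 K; g \<in> Cell1 K; cod1 K f = dom1 K g\<rbrakk> \<Longrightarrow> dom1 K (cmp1 K f g) = dom1 K f"
  "\<lbrakk>f \<in> Cell1 K; g \<in> Cell1 K; cod1 K f = dom1 K g\<rbrakk> \<Longrightarrow> cod1 K (cmp1 K f g) = cod1 K g"
  "\<lbrakk>f \<in> Cell1 K; A = dom1 K f\<rbrakk> \<Longrightarrow> cmp1 K (id1 K A) f = f"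
  "\<lbrakk>f \<in> Cell1 K; A = cod1 K f\<rbrakk> \<Longrightarrow> cmp1 K f (id1 K A) = f"
  "\<lbrakk>f \<in> Cell1 K; g \<in> Cell1 K; h \<in> Cell1 K; cod1 K f = dom1 K g; cod1 K g = dom1 K h\<rbrakk> \<Longrightarrow>
     cmp1 K (cmp1 K f g) h = cmp1 K f (cmp1 K g h)"
  using two_category
  unfolding two_category_def functor_between_def category_def cell1_cat_def
  by simp_all

lemma cell2_ver:
  "\<alpha> \<in> Cell2 K \<Longrightarrow> dom2 K \<alpha> \<in> Cell1 K"
  "\<alpha> \<in> Cell2 K \<Longrightarrow> cod2 K \<alpha> \<in> Cell1 K"
  "f \<in> Cell1 K \<Longrightarrow> id2 K f \<in> Cell2 K"
  "f \<in> Cell1 K \<Longrightarrow> dom2 K (id2 K f) = f"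
  "f \<in> Cell1 K \<Longrightarrow> cod2 K (id2 K f) = f"
  "\<lbrakk>\<alpha> \<in> Cell2 K; \<beta> \<in> Cell2 K; cod2 K \<alpha> = dom2 K \<beta>\<rbrakk> \<Longrightarrow> vc2 K \<alpha> \<beta> \<in> Cell2 K"
  "\<lbrakk>\<alpha> \<in> Cell2 K; \<beta> \<in> Cell2 K; cod2 K \<alpha> = dom2 K \<beta>\<rbrakk> \<Longrightarrow> dom2 K (vc2 K \<alpha> \<beta>) = dom2 K \<alpha>"
  "\<lbrakk>\<alpha> \<in> Cell2 K; \<beta> \<in> Cell2 K; cod2 K \<alpha> = dom2 K \<beta>\<rbrakk> \<Longrightarrow> cod2 K (vc2 K \<alpha> \<beta>) = cod2 K \<beta>"
  "\<lbrakk>\<alpha> \<in> Cell2 K; f = dom2 K \<alpha>\<rbrakk> \<Longrightarrow> vc2 K (id2 K f) \<alpha> = \<alpha>"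
  "\<lbrakk>\<alpha> \<in> Cell2 K; f = cod2 K \<alpha>\<rbrakk> \<Longrightarrow> vc2 K \<alpha> (id2 K f) = \<alpha>"
  "\<lbrakk>\<alpha> \<in> Cell2 K; \<beta> \<in> Cell2 K; \<gamma> \<in> Cell2 K; cod2 K \<alpha> = dom2 K \<beta>; cod2 K \<beta> = dom2 K \<gamma>\<rbrakk> \<Longrightarrow>
     vc2 K (vc2 K \<alpha> \<beta>) \<gamma> = vc2 K \<alpha> (vc2 K \<beta> \<gamma>)"
  using two_category[unfolded two_category_def, THEN conjunct1]
  unfolding category_def cell2_vcat_def
  by simp_all

lemma cell2_hor:
  "\<alpha> \<in> Cell2 K \<Longrightarrow> dom1 K (cod2 K \<alpha>) = dom1 K (dom2 K \<alpha>)"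
  "\<alpha> \<in> Cell2 K \<Longrightarrow> cod1 K (cod2 K \<alpha>) = cod1 K (dom2 K \<alpha>)"
  "\<lbrakk>\<alpha> \<in> Cell2 K; \<beta> \<in> Cell2 K; cod1 K (dom2 K \<alpha>) = dom1 K (dom2 K \<beta>)\<rbrakk> \<Longrightarrow> hc2 K \<alpha> \<beta> \<in> Cell2 K"
  "\<lbrakk>\<alpha> \<in> Cell2 K; \<beta> \<in> Cell2 K; cod1 K (dom2 K \<alpha>) = dom1 K (dom2 K \<beta>)\<rbrakk> \<Longrightarrow>
     dom2 K (hc2 K \<alpha> \<beta>) = cmp1 K (dom2 K \<alpha>) (dom2 K \<beta>)"
  "\<lbrakk>\<alpha> \<in> Cell2 K; \<beta> \<in> Cell2 K; cod1 K (dom2 K \<alpha>) = dom1 K (dom2 K \<beta>)\<rbrakk> \<Longrightarrow>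
     cod2 K (hc2 K \<alpha> \<beta>) = cmp1 K (cod2 K \<alpha>) (cod2 K \<beta>)"
  "\<lbrakk>\<alpha> \<in> Cell2 K; A = dom1 K (dom2 K \<alpha>)\<rbrakk> \<Longrightarrow> hc2 K (id2 K (id1 K A)) \<alpha> = \<alpha>"
  "\<lbrakk>\<alpha> \<in> Cell2 K; A = cod1 K (dom2 K \<alpha>)\<rbrakk> \<Longrightarrow> hc2 K \<alpha> (id2 K (id1 K A)) = \<alpha>"
  using two_category
  unfolding two_category_def functor_between_def category_def cell1_cat_def cell2_vcat_def
    cell2_hcat_def
  by simp_all

lemmas cell2 = cell2_ver cell2_hor

lemma hc2_assoc:
  "\<lbrakk>\<alpha> \<in> Cell2 K; \<beta> \<in> Cell2 K; \<gamma> \<in> Cell2 K; cod1 K (dom2 K \<alpha>) = dom1 K (dom2 K \<beta>);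
    cod1 K (dom2 K \<beta>) = dom1 K (dom2 K \<gamma>)\<rbrakk> \<Longrightarrow>
     hc2 K (hc2 K \<alpha> \<beta>) \<gamma> = hc2 K \<alpha> (hc2 K \<beta> \<gamma>)"
  using two_category
  unfolding two_category_def functor_between_def category_def cell2_hcat_def
  by simp

lemma hc2_id2:
  "\<lbrakk>f \<in> Cell1 K; g \<in> Cell1 K; cod1 K f = dom1 K g\<rbrakk> \<Longrightarrow>
     hc2 K (id2 K f) (id2 K g) = id2 K (cmp1 K f g)"
  using two_category
  unfolding two_category_def functor_between_def cell1_cat_def cell2_hcat_def
  by simp

lemma interchange2:
  "\<lbrakk>\<alpha> \<in> Cell2 K; \<beta> \<in> Cell2 K; \<gamma> \<in> Cell2 K; \<delta> \<in> Cell2 K; cod2 K \<alpha> = dom2 K \<gamma>;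
    cod2 K \<beta> = dom2 K \<delta>; cod1 K (dom2 K \<alpha>) = dom1 K (dom2 K \<beta>)\<rbrakk> \<Longrightarrow>
     vc2 K (hc2 K \<alpha> \<beta>) (hc2 K \<gamma> \<delta>) = hc2 K (vc2 K \<alpha> \<gamma>) (vc2 K \<beta> \<delta>)"
  using two_category unfolding two_category_def by simp

text \<open>Together with the laws above, these rules bring every pasting of whiskered cells into the form
  of a right-nested vertical composite of cells \<open>f \<cdot> (\<alpha> \<cdot> g)\<close>.\<close>

lemma whisker:
  "\<lbrakk>f \<in> Cell1 K; g \<in> Cell1 K; \<alpha> \<in> Cell2 K; cod1 K f = dom1 K g; cod1 K g = dom1 K (dom2 K \<alpha>)\<rbrakk> \<Longrightarrow>
     hc2 K (id2 K f) (hc2 K (id2 K g) \<alpha>) = hc2 K (id2 K (cmp1 K f g)) \<alpha>"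
  "\<lbrakk>f \<in> Cell1 K; g \<in> Cell1 K; \<alpha> \<in> Cell2 K; cod1 K (dom2 K \<alpha>) = dom1 K f; cod1 K f = dom1 K g\<rbrakk> \<Longrightarrow>
     hc2 K (hc2 K \<alpha> (id2 K f)) (id2 K g) = hc2 K \<alpha> (id2 K (cmp1 K f g))"
  "\<lbrakk>f \<in> Cell1 K; g \<in> Cell1 K; \<alpha> \<in> Cell2 K; cod1 K (dom2 K \<alpha>) = dom1 K g;
    cod1 K f = dom1 K (dom2 K \<alpha>)\<rbrakk> \<Longrightarrow>
     hc2 K (hc2 K (id2 K f) \<alpha>) (id2 K g) = hc2 K (id2 K f) (hc2 K \<alpha> (id2 K g))"
  "\<lbrakk>f \<in> Cell1 K; \<alpha> \<in> Cell2 K; \<beta> \<in> Cell2 K; cod2 K \<alpha> = dom2 K \<beta>; cod1 K f = dom1 K (dom2 K \<alpha>)\<rbrakk> \<Longrightarrow>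
     hc2 K (id2 K f) (vc2 K \<alpha> \<beta>) = vc2 K (hc2 K (id2 K f) \<alpha>) (hc2 K (id2 K f) \<beta>)"
  "\<lbrakk>f \<in> Cell1 K; \<alpha> \<in> Cell2 K; \<beta> \<in> Cell2 K; cod2 K \<alpha> = dom2 K \<beta>; cod1 K (dom2 K \<alpha>) = dom1 K f\<rbrakk> \<Longrightarrow>
     hc2 K (vc2 K \<alpha> \<beta>) (id2 K f) = vc2 K (hc2 K \<alpha> (id2 K f)) (hc2 K \<beta> (id2 K f))"
  \<comment> \<open>In the first law the reversed instance of associativity brings the two identity
    cells together, and \<open>hc2_id2\<close> fuses them. The distributive laws are interchange
    read from right to left, with \<open>id2 K f\<close> as the vertical composite of itself with
    itself.\<close>
  by (simp_all add: cell1 cell2 hc2_assoc hc2_id2 interchange2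
      flip: hc2_assoc[of "id2 K f" "id2 K g"])

lemmas pasting = cell1 cell2 hc2_id2 whisker

text \<open>Both sides are equal to \<open>hc2 K \<alpha> \<beta>\<close> by interchange. As a
  rewrite rule this would have no preferred direction, so it stays outside \<open>pasting\<close>
  and is applied by hand.\<close>

lemma exchange:
  assumes "\<alpha> \<in> Cell2 K" "\<beta> \<in> Cell2 K" "cod1 K (dom2 K \<alpha>) = dom1 K (dom2 K \<beta>)"
    and "f = dom2 K \<alpha>" "f' = cod2 K \<alpha>" "g = dom2 K \<beta>" "g' = cod2 K \<beta>"
  shows "vc2 K (hc2 K (id2 K f) \<beta>) (hc2 K \<alpha> (id2 K g')) =
         vc2 K (hc2 K \<alpha> (id2 K g)) (hc2 K (id2 K f') \<beta>)"
  using assms by (simp add: pasting interchange2)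

text \<open>In a right-nested composite the two cells to be swapped do not form a subterm unless
  they come last; \<open>\<epsilon>\<close> stands for whatever follows them.\<close>

lemma exchange_tail:
  assumes "\<alpha> \<in> Cell2 K" "\<beta> \<in> Cell2 K" "cod1 K (dom2 K \<alpha>) = dom1 K (dom2 K \<beta>)"
    and "f = dom2 K \<alpha>" "f' = cod2 K \<alpha>" "g = dom2 K \<beta>" "g' = cod2 K \<beta>"
    and "\<epsilon> \<in> Cell2 K" "dom2 K \<epsilon> = cmp1 K f' g'"
  shows "vc2 K (hc2 K (id2 K f) \<beta>) (vc2 K (hc2 K \<alpha> (id2 K g')) \<epsilon>) =
         vc2 K (hc2 K \<alpha> (id2 K g)) (vc2 K (hc2 K (id2 K f') \<beta>) \<epsilon>)"
proof -
  have "vc2 K (vc2 K (hc2 K (id2 K f) \<beta>) (hc2 K \<alpha> (id2 K g'))) \<epsilon> =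
        vc2 K (vc2 K (hc2 K \<alpha> (id2 K g)) (hc2 K (id2 K f') \<beta>)) \<epsilon>"
    using exchange[OF assms(1-7)] by simp
  then show ?thesis
    using assms by (simp add: pasting)
qed

section \<open>The double category of inverse quintets\<close>

definition quintet :: "'m \<Rightarrow> 'm \<Rightarrow> 'm \<Rightarrow> 'm \<Rightarrow> 'c \<Rightarrow> bool" where
  "quintet f g j k \<alpha> \<longleftrightarrow>
     f \<in> Cell1 K \<and> g \<in> Cell1 K \<and> j \<in> Cell1 K \<and> k \<in> Cell1 K \<and>
     cod1 K j = dom1 K f \<and> dom1 K j = dom1 K g \<and>
     cod1 K k = cod1 K f \<and> dom1 K k = cod1 K g \<and>
     \<alpha> \<in> Cell2 K \<and> dom2 K \<alpha> = cmp1 K j f \<and> cod2 K \<alpha> = cmp1 K g k"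

lemma inverse_quintets_simps:
  "Obj (inverse_quintets K) = Cell0 K"
  "Hor (inverse_quintets K) = Cell1 K"
  "Ver (inverse_quintets K) = Cell1 K"
  "Sqr (inverse_quintets K) = {s. quintet (ftop s) (fbot s) (flft s) (frgt s) (fcell s)}"
  "hdom (inverse_quintets K) = dom1 K"
  "hcod (inverse_quintets K) = cod1 K"
  "hid (inverse_quintets K) = id1 K"
  "hcmp (inverse_quintets K) = cmp1 K"
  "vdom (inverse_quintets K) = cod1 K"
  "vcod (inverse_quintets K) = dom1 K"
  "vid (inverse_quintets K) = id1 K"
  "vcmp (inverse_quintets K) j j' = cmp1 K j' j"
  "stop (inverse_quintets K) = ftop"
  "sbot (inverse_quintets K) = fbot"
  "slft (inverse_quintets K) = flft"
  "srgt (inverse_quintets K) = frgt"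
  "ih (inverse_quintets K) j = Framed (id1 K (cod1 K j)) (id1 K (dom1 K j)) j j (id2 K j)"
  "shc (inverse_quintets K) s s' =
     Framed (cmp1 K (ftop s) (ftop s')) (cmp1 K (fbot s) (fbot s')) (flft s) (frgt s')
       (vc2 K (hc2 K (fcell s) (id2 K (ftop s'))) (hc2 K (id2 K (fbot s)) (fcell s')))"
  "iv (inverse_quintets K) f = Framed f f (id1 K (dom1 K f)) (id1 K (cod1 K f)) (id2 K f)"
  "svc (inverse_quintets K) s s' =
     Framed (ftop s) (fbot s') (cmp1 K (flft s') (flft s)) (cmp1 K (frgt s') (frgt s))
       (vc2 K (hc2 K (id2 K (flft s')) (fcell s)) (hc2 K (fcell s') (id2 K (frgt s))))"
proof -
  show "Sqr (inverse_quintets K) = {s. quintet (ftop s) (fbot s) (flft s) (frgt s) (fcell s)}"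
    \<comment> \<open>A framed cell is determined by its five selectors, which turns the existential
      description of the squares into a condition on the selectors.\<close>
    unfolding inverse_quintets_def quintet_def by (force intro: framed.expand)
qed (simp_all add: inverse_quintets_def)

lemma category_inverse_quintets:
  "category (hor_cat (inverse_quintets K))"
  "category (ver_cat (inverse_quintets K))"
  "category (sqr_hcat (inverse_quintets K))"
  "category (sqr_vcat (inverse_quintets K))"
  unfolding category_def hor_cat_def ver_cat_def sqr_hcat_def sqr_vcat_def cat.simps
    inverse_quintets_simps
  by (auto simp: quintet_def pasting intro: framed.expand)

text \<open>In normal form both sides begin with \<alpha> and end with \<delta>. They differ only in
  which of \<beta> (upper right) and \<gamma> (lower left) comes first, and these two act on
  disjoint factors of \<open>j' \<cdot> g1 \<cdot> k \<cdot> f'\<close>-like composites only after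
  \<alpha> has been applied, so a single exchange suffices.\<close>

lemma interchange_quintets:
  assumes "quintet f g1 j k \<alpha>" "quintet f' g1' k l \<beta>" "quintet g1 h j' k' \<gamma>" "quintet g1' h' k' l' \<delta>"
  shows "vc2 K (hc2 K (id2 K j') (vc2 K (hc2 K \<alpha> (id2 K f')) (hc2 K (id2 K g1) \<beta>)))
           (hc2 K (vc2 K (hc2 K \<gamma> (id2 K g1')) (hc2 K (id2 K h) \<delta>)) (id2 K l)) =
         vc2 K (hc2 K (vc2 K (hc2 K (id2 K j') \<alpha>) (hc2 K \<gamma> (id2 K k))) (id2 K f'))
           (hc2 K (id2 K h) (vc2 K (hc2 K (id2 K k') \<beta>) (hc2 K \<delta> (id2 K l))))"
proof -
  have "vc2 K (hc2 K (id2 K (cmp1 K j' g1)) \<beta>) (vc2 K (hc2 K \<gamma> (id2 K (cmp1 K g1' l))) 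
            (hc2 K (id2 K h) (hc2 K \<delta> (id2 K l)))) =
        vc2 K (hc2 K \<gamma> (id2 K (cmp1 K k f'))) (vc2 K (hc2 K (id2 K (cmp1 K h k')) \<beta>)
            (hc2 K (id2 K h) (hc2 K \<delta> (id2 K l))))"
    using assms by (intro exchange_tail) (simp_all add: quintet_def pasting)
  then show ?thesis
    using assms by (simp add: quintet_def pasting)
qed

theorem double_category_inverse_quintets: "double_category (inverse_quintets K)"
proof -
  let ?Q = "inverse_quintets K"
  note functor_defs = functor_between_def hor_cat_def ver_cat_def sqr_hcat_def sqr_vcat_def
    cat.simps inverse_quintets_simps
  note cats = category_inverse_quintets
  have f1: "functor_between (sqr_vcat ?Q) (ver_cat ?Q) (hdom ?Q) (slft ?Q)"
    using cats unfolding functor_defs by (auto simp: quintet_def pasting)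
  have f2: "functor_between (sqr_vcat ?Q) (ver_cat ?Q) (hcod ?Q) (srgt ?Q)"
    using cats unfolding functor_defs by (auto simp: quintet_def pasting)
  have f3: "functor_between (ver_cat ?Q) (sqr_vcat ?Q) (hid ?Q) (ih ?Q)"
    using cats unfolding functor_defs by (auto simp: quintet_def pasting)
  have f4: "functor_between (sqr_hcat ?Q) (hor_cat ?Q) (vdom ?Q) (stop ?Q)"
    using cats unfolding functor_defs by (auto simp: quintet_def pasting)
  have f5: "functor_between (sqr_hcat ?Q) (hor_cat ?Q) (vcod ?Q) (sbot ?Q)"
    using cats unfolding functor_defs by (auto simp: quintet_def pasting)
  have f6: "functor_between (hor_cat ?Q) (sqr_hcat ?Q) (vid ?Q) (iv ?Q)"
    using cats unfolding functor_defs by (auto simp: quintet_def pasting)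
  have "svc ?Q (shc ?Q \<alpha> \<beta>) (shc ?Q \<gamma> \<delta>) = shc ?Q (svc ?Q \<alpha> \<gamma>) (svc ?Q \<beta> \<delta>)"
    if "\<alpha> \<in> Sqr ?Q" "\<beta> \<in> Sqr ?Q" "\<gamma> \<in> Sqr ?Q" "\<delta> \<in> Sqr ?Q"
      and "srgt ?Q \<alpha> = slft ?Q \<beta>" "srgt ?Q \<gamma> = slft ?Q \<delta>"
      and "sbot ?Q \<alpha> = stop ?Q \<gamma>" "sbot ?Q \<beta> = stop ?Q \<delta>" for \<alpha> \<beta> \<gamma> \<delta>
    using that unfolding inverse_quintets_simps mem_Collect_eq framed.sel framed.inject
    by (intro conjI refl interchange_quintets) auto
  with f1 f2 f3 f4 f5 f6 show ?thesis
    unfolding double_category_def by blast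
qed

end

section \<open>Double categories\<close>

lemma functor_betweenD:
  assumes "functor_between C D Fo Fa"
  shows "f \<in> Arrs C \<Longrightarrow> Dom D (Fa f) = Fo (Dom C f)"
    and "f \<in> Arrs C \<Longrightarrow> Cod D (Fa f) = Fo (Cod C f)"
    and "f \<in> Arrs C \<Longrightarrow> Fa f \<in> Arrs D"
    and "A \<in> Objs C \<Longrightarrow> Fa (Idt C A) = Idt D (Fo A)"
    and "\<lbrakk>f \<in> Arrs C; g \<in> Arrs C; Cod C f = Dom C g\<rbrakk> \<Longrightarrow> Fa (Comp C f g) = Comp D (Fa f) (Fa g)"
  using assms by (auto simp: functor_between_def)

lemma functor_betweenI:
  assumes "category C" "category D"
    and "\<And>A. A \<in> Objs C \<Longrightarrow> Fo A \<in> Objs D"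
    and "\<And>f. f \<in> Arrs C \<Longrightarrow> Fa f \<in> Arrs D \<and> Dom D (Fa f) = Fo (Dom C f) \<and> Cod D (Fa f) = Fo (Cod C f)"
    and "\<And>A. A \<in> Objs C \<Longrightarrow> Fa (Idt C A) = Idt D (Fo A)"
    and "\<And>f g. \<lbrakk>f \<in> Arrs C; g \<in> Arrs C; Cod C f = Dom C g\<rbrakk> \<Longrightarrow> Fa (Comp C f g) = Comp D (Fa f) (Fa g)"
  shows "functor_between C D Fo Fa"
  using assms by (simp add: functor_between_def)

lemmas double_cat_defs = hor_cat_def ver_cat_def sqr_hcat_def sqr_vcat_def cat.simps

locale dblcat =
  fixes D :: "('o, 'h, 'v, 's) dblcat"
  assumes double_category: "double_category D"
begin

lemma categories:
  "category (hor_cat D)" "category (ver_cat D)" "category (sqr_hcat D)" "category (sqr_vcat D)"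
  using double_category by (simp_all add: double_category_def functor_between_def)

lemma hor:
  "f \<in> Hor D \<Longrightarrow> hdom D f \<in> Obj D"
  "f \<in> Hor D \<Longrightarrow> hcod D f \<in> Obj D"
  "A \<in> Obj D \<Longrightarrow> hid D A \<in> Hor D"
  "A \<in> Obj D \<Longrightarrow> hdom D (hid D A) = A"
  "A \<in> Obj D \<Longrightarrow> hcod D (hid D A) = A"
  "\<lbrakk>f \<in> Hor D; g \<in> Hor D; hcod D f = hdom D g\<rbrakk> \<Longrightarrow> hcmp D f g \<in> Hor D"
  "\<lbrakk>f \<in> Hor D; g \<in> Hor D; hcod D f = hdom D g\<rbrakk> \<Longrightarrow> hdom D (hcmp D f g) = hdom D f"
  "\<lbrakk>f \<in> Hor D; g \<in> Hor D; hcod D f = hdom D g\<rbrakk> \<Longrightarrow> hcod D (hcmp D f g) = hcod D g"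
  "\<lbrakk>f \<in> Hor D; A = hdom D f\<rbrakk> \<Longrightarrow> hcmp D (hid D A) f = f"
  "\<lbrakk>f \<in> Hor D; A = hcod D f\<rbrakk> \<Longrightarrow> hcmp D f (hid D A) = f"
  "\<lbrakk>f \<in> Hor D; g \<in> Hor D; h \<in> Hor D; hcod D f = hdom D g; hcod D g = hdom D h\<rbrakk> \<Longrightarrow>
     hcmp D (hcmp D f g) h = hcmp D f (hcmp D g h)"
  using categories(1) unfolding category_def hor_cat_def by simp_all

lemma ver:
  "j \<in> Ver D \<Longrightarrow> vdom D j \<in> Obj D"
  "j \<in> Ver D \<Longrightarrow> vcod D j \<in> Obj D"
  "A \<in> Obj D \<Longrightarrow> vid D A \<in> Ver D"
  "A \<in> Obj D \<Longrightarrow> vdom D (vid D A) = A"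
  "A \<in> Obj D \<Longrightarrow> vcod D (vid D A) = A"
  "\<lbrakk>j \<in> Ver D; k \<in> Ver D; vcod D j = vdom D k\<rbrakk> \<Longrightarrow> vcmp D j k \<in> Ver D"
  "\<lbrakk>j \<in> Ver D; k \<in> Ver D; vcod D j = vdom D k\<rbrakk> \<Longrightarrow> vdom D (vcmp D j k) = vdom D j"
  "\<lbrakk>j \<in> Ver D; k \<in> Ver D; vcod D j = vdom D k\<rbrakk> \<Longrightarrow> vcod D (vcmp D j k) = vcod D k"
  "\<lbrakk>j \<in> Ver D; A = vdom D j\<rbrakk> \<Longrightarrow> vcmp D (vid D A) j = j"
  "\<lbrakk>j \<in> Ver D; A = vcod D j\<rbrakk> \<Longrightarrow> vcmp D j (vid D A) = j"
  "\<lbrakk>j \<in> Ver D; k \<in> Ver D; l \<in> Ver D; vcod D j = vdom D k; vcod D k = vdom D l\<rbrakk> \<Longrightarrow>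
     vcmp D (vcmp D j k) l = vcmp D j (vcmp D k l)"
  using categories(2) unfolding category_def ver_cat_def by simp_all

lemma sqr_hor:
  "\<alpha> \<in> Sqr D \<Longrightarrow> slft D \<alpha> \<in> Ver D"
  "\<alpha> \<in> Sqr D \<Longrightarrow> srgt D \<alpha> \<in> Ver D"
  "j \<in> Ver D \<Longrightarrow> ih D j \<in> Sqr D"
  "j \<in> Ver D \<Longrightarrow> slft D (ih D j) = j"
  "j \<in> Ver D \<Longrightarrow> srgt D (ih D j) = j"
  "\<lbrakk>\<alpha> \<in> Sqr D; \<beta> \<in> Sqr D; srgt D \<alpha> = slft D \<beta>\<rbrakk> \<Longrightarrow> shc D \<alpha> \<beta> \<in> Sqr D"
  "\<lbrakk>\<alpha> \<in> Sqr D; \<beta> \<in> Sqr D; srgt D \<alpha> = slft D \<beta>\<rbrakk> \<Longrightarrow> slft D (shc D \<alpha> \<beta>) = slft D \<alpha>"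
  "\<lbrakk>\<alpha> \<in> Sqr D; \<beta> \<in> Sqr D; srgt D \<alpha> = slft D \<beta>\<rbrakk> \<Longrightarrow> srgt D (shc D \<alpha> \<beta>) = srgt D \<beta>"
  "\<lbrakk>\<alpha> \<in> Sqr D; j = slft D \<alpha>\<rbrakk> \<Longrightarrow> shc D (ih D j) \<alpha> = \<alpha>"
  "\<lbrakk>\<alpha> \<in> Sqr D; j = srgt D \<alpha>\<rbrakk> \<Longrightarrow> shc D \<alpha> (ih D j) = \<alpha>"
  "\<lbrakk>\<alpha> \<in> Sqr D; \<beta> \<in> Sqr D; \<gamma> \<in> Sqr D; srgt D \<alpha> = slft D \<beta>; srgt D \<beta> = slft D \<gamma>\<rbrakk> \<Longrightarrow>
     shc D (shc D \<alpha> \<beta>) \<gamma> = shc D \<alpha> (shc D \<beta> \<gamma>)"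
  using categories(3) unfolding category_def sqr_hcat_def by simp_all

lemma sqr_ver:
  "\<alpha> \<in> Sqr D \<Longrightarrow> stop D \<alpha> \<in> Hor D"
  "\<alpha> \<in> Sqr D \<Longrightarrow> sbot D \<alpha> \<in> Hor D"
  "f \<in> Hor D \<Longrightarrow> iv D f \<in> Sqr D"
  "f \<in> Hor D \<Longrightarrow> stop D (iv D f) = f"
  "f \<in> Hor D \<Longrightarrow> sbot D (iv D f) = f"
  "\<lbrakk>\<alpha> \<in> Sqr D; \<beta> \<in> Sqr D; sbot D \<alpha> = stop D \<beta>\<rbrakk> \<Longrightarrow> svc D \<alpha> \<beta> \<in> Sqr D"
  "\<lbrakk>\<alpha> \<in> Sqr D; \<beta> \<in> Sqr D; sbot D \<alpha> = stop D \<beta>\<rbrakk> \<Longrightarrow> stop D (svc D \<alpha> \<beta>) = stop D \<alpha>"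
  "\<lbrakk>\<alpha> \<in> Sqr D; \<beta> \<in> Sqr D; sbot D \<alpha> = stop D \<beta>\<rbrakk> \<Longrightarrow> sbot D (svc D \<alpha> \<beta>) = sbot D \<beta>"
  "\<lbrakk>\<alpha> \<in> Sqr D; f = stop D \<alpha>\<rbrakk> \<Longrightarrow> svc D (iv D f) \<alpha> = \<alpha>"
  "\<lbrakk>\<alpha> \<in> Sqr D; f = sbot D \<alpha>\<rbrakk> \<Longrightarrow> svc D \<alpha> (iv D f) = \<alpha>"
  "\<lbrakk>\<alpha> \<in> Sqr D; \<beta> \<in> Sqr D; \<gamma> \<in> Sqr D; sbot D \<alpha> = stop D \<beta>; sbot D \<beta> = stop D \<gamma>\<rbrakk> \<Longrightarrow>
     svc D (svc D \<alpha> \<beta>) \<gamma> = svc D \<alpha> (svc D \<beta> \<gamma>)"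
  using categories(4) unfolding category_def sqr_vcat_def by simp_all

lemma functors:
  "functor_between (sqr_vcat D) (ver_cat D) (hdom D) (slft D)"
  "functor_between (sqr_vcat D) (ver_cat D) (hcod D) (srgt D)"
  "functor_between (ver_cat D) (sqr_vcat D) (hid D) (ih D)"
  "functor_between (sqr_hcat D) (hor_cat D) (vdom D) (stop D)"
  "functor_between (sqr_hcat D) (hor_cat D) (vcod D) (sbot D)"
  "functor_between (hor_cat D) (sqr_hcat D) (vid D) (iv D)"
  using double_category by (simp_all add: double_category_def)

text \<open>The corner equations, items 1 and 2, are taken from \<open>slft\<close> and
  \<open>srgt\<close> only. Those of \<open>stop\<close> and \<open>sbot\<close> are the same
  equations read backwards, and rewriting with both would not terminate.\<close>

lemmas sqr_sides =
  functor_betweenD(1,2,4,5)[OF functors(1), unfolded double_cat_defs]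
  functor_betweenD(1,2,4,5)[OF functors(2), unfolded double_cat_defs]
  functor_betweenD(4,5)[OF functors(4), unfolded double_cat_defs]
  functor_betweenD(4,5)[OF functors(5), unfolded double_cat_defs]

text \<open>Composites of identity squares are fused into one. The last law makes
  \<open>ih D (vid D A)\<close> the preferred name of the identity square of an object, which is the
  form that the horizontal unit laws recognise.\<close>

lemmas sqr_ids =
  functor_betweenD(5)[OF functors(3), unfolded double_cat_defs, symmetric]
  functor_betweenD(5)[OF functors(6), unfolded double_cat_defs, symmetric]
  functor_betweenD(4)[OF functors(6), unfolded double_cat_defs]

lemma interchange:
  "\<lbrakk>\<alpha> \<in> Sqr D; \<beta> \<in> Sqr D; \<gamma> \<in> Sqr D; \<delta> \<in> Sqr D; srgt D \<alpha> = slft D \<beta>; srgt D \<gamma> = slft D \<delta>;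
    sbot D \<alpha> = stop D \<gamma>; sbot D \<beta> = stop D \<delta>\<rbrakk> \<Longrightarrow>
     svc D (shc D \<alpha> \<beta>) (shc D \<gamma> \<delta>) = shc D (svc D \<alpha> \<gamma>) (svc D \<beta> \<delta>)"
  using double_category by (simp add: double_category_def)

lemmas sqr = hor ver sqr_hor sqr_ver sqr_sides sqr_ids

section \<open>The horizontal 2-category of a double category\<close>

lemma horizontal_2cat_simps:
  "Cell0 (horizontal_2cat D) = Obj D"
  "Cell1 (horizontal_2cat D) = Hor D"
  "dom1 (horizontal_2cat D) = hdom D"
  "cod1 (horizontal_2cat D) = hcod D"
  "id1 (horizontal_2cat D) = hid D"
  "cmp1 (horizontal_2cat D) = hcmp D"
  "dom2 (horizontal_2cat D) = stop D"
  "cod2 (horizontal_2cat D) = sbot D"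
  "id2 (horizontal_2cat D) = iv D"
  "vc2 (horizontal_2cat D) = svc D"
  "hc2 (horizontal_2cat D) = shc D"
  by (simp_all add: horizontal_2cat_def)

lemma Cell2_iff:
  "\<alpha> \<in> Cell2 (horizontal_2cat D) \<longleftrightarrow>
     \<alpha> \<in> Sqr D \<and> slft D \<alpha> = vid D (hdom D (stop D \<alpha>)) \<and> srgt D \<alpha> = vid D (hcod D (stop D \<alpha>))"
  by (simp add: horizontal_2cat_def)

text \<open>\<open>Cell2\<close> prescribes the vertical sides through the ends of the top alone.
  The bottom has the same ends because an identity vertical morphism starts and ends at the same
  object.\<close>

lemma Cell2_sides:
  assumes "\<alpha> \<in> Cell2 (horizontal_2cat D)"
  shows "hdom D (sbot D \<alpha>) = hdom D (stop D \<alpha>)" "hcod D (sbot D \<alpha>) = hcod D (stop D \<alpha>)"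
  using assms sqr_sides(2,6)[of \<alpha>] by (simp_all add: Cell2_iff sqr)

lemma Cell2:
  "\<alpha> \<in> Cell2 (horizontal_2cat D) \<Longrightarrow> \<alpha> \<in> Sqr D"
  "\<alpha> \<in> Cell2 (horizontal_2cat D) \<Longrightarrow> slft D \<alpha> = vid D (hdom D (stop D \<alpha>))"
  "\<alpha> \<in> Cell2 (horizontal_2cat D) \<Longrightarrow> srgt D \<alpha> = vid D (hcod D (stop D \<alpha>))"
  "f \<in> Hor D \<Longrightarrow> iv D f \<in> Cell2 (horizontal_2cat D)"
  "A \<in> Obj D \<Longrightarrow> ih D (vid D A) \<in> Cell2 (horizontal_2cat D)"
  "\<lbrakk>\<alpha> \<in> Cell2 (horizontal_2cat D); \<beta> \<in> Cell2 (horizontal_2cat D); hcod D (stop D \<alpha>) = hdom D (stop D \<beta>)\<rbrakk> \<Longrightarrow>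
     shc D \<alpha> \<beta> \<in> Cell2 (horizontal_2cat D)"
  by (simp_all add: Cell2_iff sqr)

lemma Cell2_svc:
  "\<lbrakk>\<alpha> \<in> Cell2 (horizontal_2cat D); \<beta> \<in> Cell2 (horizontal_2cat D); sbot D \<alpha> = stop D \<beta>\<rbrakk> \<Longrightarrow>
     svc D \<alpha> \<beta> \<in> Cell2 (horizontal_2cat D)"
  using Cell2_sides[of \<alpha>] by (simp add: Cell2_iff sqr)

lemma two_category_horizontal_2cat: "two_category (horizontal_2cat D)"
proof -
  note functor_defs = functor_between_def cell1_cat_def cell2_hcat_def cell2_vcat_def
    cat.simps horizontal_2cat_simps
  have c1: "category (cell1_cat (horizontal_2cat D))"
    using categories(1) by (simp add: cell1_cat_def horizontal_2cat_simps hor_cat_def)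
  have c2: "category (cell2_vcat (horizontal_2cat D))"
    unfolding category_def functor_defs by (auto simp: Cell2 Cell2_svc sqr Cell2_sides)
  have c3: "category (cell2_hcat (horizontal_2cat D))"
    unfolding category_def functor_defs by (auto simp: Cell2 Cell2_svc sqr Cell2_sides)
  have f1: "functor_between (cell2_hcat (horizontal_2cat D)) (cell1_cat (horizontal_2cat D))
      (\<lambda>A. A) (dom2 (horizontal_2cat D))"
    using c1 c3 unfolding functor_defs by (auto simp: Cell2 sqr)
  have f2: "functor_between (cell2_hcat (horizontal_2cat D)) (cell1_cat (horizontal_2cat D))
      (\<lambda>A. A) (cod2 (horizontal_2cat D))"
    using c1 c3 unfolding functor_defs by (auto simp: Cell2 Cell2_svc sqr Cell2_sides)
  have f3: "functor_between (cell1_cat (horizontal_2cat D)) (cell2_hcat (horizontal_2cat D))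
      (\<lambda>A. A) (id2 (horizontal_2cat D))"
    using c1 c3 unfolding functor_defs by (auto simp: Cell2 sqr)
  have "svc D (shc D \<alpha> \<beta>) (shc D \<gamma> \<delta>) = shc D (svc D \<alpha> \<gamma>) (svc D \<beta> \<delta>)"
    if "\<alpha> \<in> Cell2 (horizontal_2cat D)" "\<beta> \<in> Cell2 (horizontal_2cat D)"
      "\<gamma> \<in> Cell2 (horizontal_2cat D)" "\<delta> \<in> Cell2 (horizontal_2cat D)"
      "sbot D \<alpha> = stop D \<gamma>" "sbot D \<beta> = stop D \<delta>" "hcod D (stop D \<alpha>) = hdom D (stop D \<beta>)"
    for \<alpha> \<beta> \<gamma> \<delta>
    using that Cell2_sides(2)[of \<alpha>] Cell2_sides(1)[of \<beta>] by (simp add: Cell2 interchange)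
  with c2 f1 f2 f3 show ?thesis
    unfolding two_category_def horizontal_2cat_simps by blast
qed

text \<open>This provides the rules of \<open>pasting\<close> in terms of the operations of
  \<open>D\<close> itself. Membership in \<open>Cell2 (horizontal_2cat D)\<close> is deliberately
  kept: as a side condition it tells the 2-cells, which can be whiskered, from general squares, for
  which only the rules of \<open>sqr\<close> hold.\<close>

sublocale two_cat "horizontal_2cat D"
  rewrites "Cell0 (horizontal_2cat D) = Obj D"
    and "Cell1 (horizontal_2cat D) = Hor D"
    and "dom1 (horizontal_2cat D) = hdom D"
    and "cod1 (horizontal_2cat D) = hcod D"
    and "id1 (horizontal_2cat D) = hid D"
    and "cmp1 (horizontal_2cat D) = hcmp D"
    and "dom2 (horizontal_2cat D) = stop D"
    and "cod2 (horizontal_2cat D) = sbot D"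
    and "id2 (horizontal_2cat D) = iv D"
    and "vc2 (horizontal_2cat D) = svc D"
    and "hc2 (horizontal_2cat D) = shc D"
  by (rule two_cat.intro[OF two_category_horizontal_2cat]) (rule horizontal_2cat_simps)+

end

section \<open>Endomorphism maps and squares\<close>

context dblcat
begin

lemma endomorphism:
  "endomorphism D E \<Longrightarrow> base E \<in> Obj D"
  "endomorphism D E \<Longrightarrow> emor E \<in> Hor D"
  "endomorphism D E \<Longrightarrow> hdom D (emor E) = base E"
  "endomorphism D E \<Longrightarrow> hcod D (emor E) = base E"
  by (simp_all add: endomorphism_def)

lemma endo_hmap:
  "endo_hmap D m \<Longrightarrow> endomorphism D (hsrc m)"
  "endo_hmap D m \<Longrightarrow> endomorphism D (htgt m)"
  "endo_hmap D m \<Longrightarrow> hmor m \<in> Hor D"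
  "endo_hmap D m \<Longrightarrow> hdom D (hmor m) = base (hsrc m)"
  "endo_hmap D m \<Longrightarrow> hcod D (hmor m) = base (htgt m)"
  "endo_hmap D m \<Longrightarrow> hcell m \<in> Cell2 (horizontal_2cat D)"
  "endo_hmap D m \<Longrightarrow> stop D (hcell m) = hcmp D (hmor m) (emor (htgt m))"
  "endo_hmap D m \<Longrightarrow> sbot D (hcell m) = hcmp D (emor (hsrc m)) (hmor m)"
  by (simp_all add: endo_hmap_def two_cell_def)

lemma endo_vmap:
  "endo_vmap D m \<Longrightarrow> endomorphism D (vsrc m)"
  "endo_vmap D m \<Longrightarrow> endomorphism D (vtgt m)"
  "endo_vmap D m \<Longrightarrow> vmor m \<in> Ver D"
  "endo_vmap D m \<Longrightarrow> vdom D (vmor m) = base (vsrc m)"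
  "endo_vmap D m \<Longrightarrow> vcod D (vmor m) = base (vtgt m)"
  "endo_vmap D m \<Longrightarrow> vsqr m \<in> Sqr D"
  "endo_vmap D m \<Longrightarrow> stop D (vsqr m) = emor (vsrc m)"
  "endo_vmap D m \<Longrightarrow> sbot D (vsqr m) = emor (vtgt m)"
  "endo_vmap D m \<Longrightarrow> slft D (vsqr m) = vmor m"
  "endo_vmap D m \<Longrightarrow> srgt D (vsqr m) = vmor m"
  by (simp_all add: endo_vmap_def squares_def)

lemmas endo = endomorphism endo_hmap endo_vmap

lemma hmap_id_sel:
  "hsrc (hmap_id D E) = E" "htgt (hmap_id D E) = E"
  "hmor (hmap_id D E) = hid D (base E)" "hcell (hmap_id D E) = iv D (emor E)"
  by (simp_all add: hmap_id_def)

lemma vmap_id_sel: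
  "vsrc (vmap_id D E) = E" "vtgt (vmap_id D E) = E"
  "vmor (vmap_id D E) = vid D (base E)" "vsqr (vmap_id D E) = iv D (emor E)"
  by (simp_all add: vmap_id_def)

lemma hmap_comp_sel:
  "hsrc (hmap_comp D m n) = hsrc m" "htgt (hmap_comp D m n) = htgt n"
  "hmor (hmap_comp D m n) = hcmp D (hmor m) (hmor n)"
  "hcell (hmap_comp D m n) =
     svc D (shc D (iv D (hmor m)) (hcell n)) (shc D (hcell m) (iv D (hmor n)))"
  by (simp_all add: hmap_comp_def)

lemma vmap_comp_sel:
  "vsrc (vmap_comp D m n) = vsrc m" "vtgt (vmap_comp D m n) = vtgt n"
  "vmor (vmap_comp D m n) = vcmp D (vmor m) (vmor n)"
  "vsqr (vmap_comp D m n) = svc D (vsqr m) (vsqr n)"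
  by (simp_all add: vmap_comp_def)

lemmas map_sel = hmap_id_sel vmap_id_sel hmap_comp_sel vmap_comp_sel

lemma endo_hmap_id: "endomorphism D E \<Longrightarrow> endo_hmap D (hmap_id D E)"
  unfolding endo_hmap_def two_cell_def by (simp add: map_sel endo pasting Cell2)

lemma endo_hmap_comp:
  "\<lbrakk>endo_hmap D m; endo_hmap D n; htgt m = hsrc n\<rbrakk> \<Longrightarrow> endo_hmap D (hmap_comp D m n)"
  unfolding endo_hmap_def[of D "hmap_comp D m n"] two_cell_def by (simp add: map_sel endo pasting Cell2)

lemma endo_vmap_id: "endomorphism D E \<Longrightarrow> endo_vmap D (vmap_id D E)"
  unfolding endo_vmap_def squares_def by (simp add: map_sel endo sqr)

lemma endo_vmap_comp:
  "\<lbrakk>endo_vmap D m; endo_vmap D n; vtgt m = vsrc n\<rbrakk> \<Longrightarrow> endo_vmap D (vmap_comp D m n)"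
  unfolding endo_vmap_def[of D "vmap_comp D m n"] squares_def by (simp add: map_sel endo sqr)

lemma hmap_category:
  "\<lbrakk>endo_hmap D m; E = hsrc m\<rbrakk> \<Longrightarrow> hmap_comp D (hmap_id D E) m = m"
  "\<lbrakk>endo_hmap D m; E = htgt m\<rbrakk> \<Longrightarrow> hmap_comp D m (hmap_id D E) = m"
  "\<lbrakk>endo_hmap D m; endo_hmap D n; endo_hmap D p; htgt m = hsrc n; htgt n = hsrc p\<rbrakk> \<Longrightarrow>
     hmap_comp D (hmap_comp D m n) p = hmap_comp D m (hmap_comp D n p)"
  by (rule hmap.expand; simp add: map_sel endo pasting Cell2)+

lemma vmap_category:
  "\<lbrakk>endo_vmap D m; E = vsrc m\<rbrakk> \<Longrightarrow> vmap_comp D (vmap_id D E) m = m"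
  "\<lbrakk>endo_vmap D m; E = vtgt m\<rbrakk> \<Longrightarrow> vmap_comp D m (vmap_id D E) = m"
  "\<lbrakk>endo_vmap D m; endo_vmap D n; endo_vmap D p; vtgt m = vsrc n; vtgt n = vsrc p\<rbrakk> \<Longrightarrow>
     vmap_comp D (vmap_comp D m n) p = vmap_comp D m (vmap_comp D n p)"
  by (rule vmap.expand; simp add: map_sel endo sqr)+

text \<open>All requirements on an endomorphism square between endomorphism maps except its
  equation. Full faithfulness has to speak of candidates whose equation is still to be
  proved.\<close>

definition framed_by_endo_maps ::
  "(('o, 'h, 'z) endo_scheme, 'h, 'v, 's) esquare \<Rightarrow> bool" where
  "framed_by_endo_maps s \<longleftrightarrow>
     endo_hmap D (ftop s) \<and> endo_hmap D (fbot s) \<and> endo_vmap D (flft s) \<and> endo_vmap D (frgt s) \<and>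
     hsrc (ftop s) = vsrc (flft s) \<and> htgt (ftop s) = vsrc (frgt s) \<and>
     hsrc (fbot s) = vtgt (flft s) \<and> htgt (fbot s) = vtgt (frgt s) \<and>
     fcell s \<in> squares D (hmor (ftop s)) (hmor (fbot s)) (vmor (flft s)) (vmor (frgt s))"

lemma framed_by_endo_maps:
  assumes "framed_by_endo_maps s"
  shows "endo_hmap D (ftop s)" "endo_hmap D (fbot s)" "endo_vmap D (flft s)" "endo_vmap D (frgt s)"
    and "hsrc (ftop s) = vsrc (flft s)" "htgt (ftop s) = vsrc (frgt s)"
    and "hsrc (fbot s) = vtgt (flft s)" "htgt (fbot s) = vtgt (frgt s)"
    and "fcell s \<in> Sqr D" "stop D (fcell s) = hmor (ftop s)" "sbot D (fcell s) = hmor (fbot s)"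
    and "slft D (fcell s) = vmor (flft s)" "srgt D (fcell s) = vmor (frgt s)"
  using assms by (simp_all add: framed_by_endo_maps_def squares_def)

lemma endo_square_iff:
  assumes "framed_by_endo_maps s"
  shows "endo_square D s \<longleftrightarrow>
     svc D (hcell (ftop s)) (shc D (vsqr (flft s)) (fcell s)) =
     svc D (shc D (fcell s) (vsqr (frgt s))) (hcell (fbot s))"
  using assms by (simp add: endo_square_def framed_by_endo_maps_def)

text \<open>The equation \<open>1\<close> is that of \<open>s\<close> with \<open>fcell s'\<close>
  pasted on its right, and \<open>2\<close> is that of \<open>s'\<close> with \<open>fcell s\<close>
  pasted on its left. Both come from interchange after a vertical identity square has been inserted
  to give the two columns equal height.\<close>

lemma endo_square_shc:
  assumes s: "framed_by_endo_maps s" "endo_square D s"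
    and s': "framed_by_endo_maps s'" "endo_square D s'"
    and *: "frgt s = flft s'"
  shows "svc D (hcell (hmap_comp D (ftop s) (ftop s')))
           (shc D (vsqr (flft s)) (shc D (fcell s) (fcell s'))) =
         svc D (shc D (shc D (fcell s) (fcell s')) (vsqr (frgt s')))
           (hcell (hmap_comp D (fbot s) (fbot s')))"
proof -
  note simps = framed_by_endo_maps[OF s(1)] framed_by_endo_maps[OF s'(1)] * endo sqr Cell2
  let ?\<alpha> = "fcell s" and ?\<beta> = "fcell s'"
  let ?u = "vsqr (flft s)" and ?v = "vsqr (frgt s)" and ?w = "vsqr (frgt s')"
  let ?F = "hmor (ftop s)" and ?G = "hmor (ftop s')" and ?F' = "hmor (fbot s)" and ?G' = "hmor (fbot s')"
  let ?\<phi> = "hcell (ftop s)" and ?\<psi> = "hcell (ftop s')"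
  let ?\<phi>' = "hcell (fbot s)" and ?\<psi>' = "hcell (fbot s')"
  have eqs: "svc D ?\<phi> (shc D ?u ?\<alpha>) = svc D (shc D ?\<alpha> ?v) ?\<phi>'"
    "svc D ?\<psi> (shc D ?v ?\<beta>) = svc D (shc D ?\<beta> ?w) ?\<psi>'"
    using s s' * by (simp_all add: endo_square_def)
  have "svc D (shc D ?\<phi> (iv D ?G)) (shc D (shc D ?u ?\<alpha>) ?\<beta>) = shc D (svc D ?\<phi> (shc D ?u ?\<alpha>)) ?\<beta>"
    by (subst interchange) (simp_all add: simps)
  also have "\<dots> = shc D (svc D (shc D ?\<alpha> ?v) ?\<phi>') (svc D ?\<beta> (iv D ?G'))"
    by (simp add: eqs) (simp add: simps)
  also have "\<dots> = svc D (shc D (shc D ?\<alpha> ?v) ?\<beta>) (shc D ?\<phi>' (iv D ?G'))"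
    by (subst interchange) (simp_all add: simps)
  finally have 1: "svc D (shc D ?\<phi> (iv D ?G)) (shc D (shc D ?u ?\<alpha>) ?\<beta>) =
    svc D (shc D (shc D ?\<alpha> ?v) ?\<beta>) (shc D ?\<phi>' (iv D ?G'))" .
  have "svc D (shc D (iv D ?F) ?\<psi>) (shc D ?\<alpha> (shc D ?v ?\<beta>)) = shc D ?\<alpha> (svc D ?\<psi> (shc D ?v ?\<beta>))"
    by (subst interchange) (simp_all add: simps)
  also have "\<dots> = shc D (svc D ?\<alpha> (iv D ?F')) (svc D (shc D ?\<beta> ?w) ?\<psi>')"
    by (simp add: eqs) (simp add: simps)
  also have "\<dots> = svc D (shc D ?\<alpha> (shc D ?\<beta> ?w)) (shc D (iv D ?F') ?\<psi>')"
    by (subst interchange) (simp_all add: simps)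
  finally have 2: "svc D (shc D (iv D ?F) ?\<psi>) (shc D ?\<alpha> (shc D ?v ?\<beta>)) =
    svc D (shc D ?\<alpha> (shc D ?\<beta> ?w)) (shc D (iv D ?F') ?\<psi>')" .
  \<comment> \<open>By \<open>1\<close> the cell \<phi> passes below the row of squares and becomes
    \<phi>'; by \<open>2\<close> the cell \<psi> then passes in the same way and becomes
    \<psi>'.\<close>
  have "svc D (svc D (shc D (iv D ?F) ?\<psi>) (shc D ?\<phi> (iv D ?G))) (shc D ?u (shc D ?\<alpha> ?\<beta>)) =
    svc D (shc D (iv D ?F) ?\<psi>) (svc D (shc D ?\<phi> (iv D ?G)) (shc D (shc D ?u ?\<alpha>) ?\<beta>))"
    by (simp add: simps)
  also have "\<dots> = svc D (svc D (shc D (iv D ?F) ?\<psi>) (shc D ?\<alpha> (shc D ?v ?\<beta>))) (shc D ?\<phi>' (iv D ?G'))"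
    unfolding 1 by (simp add: simps)
  also have "\<dots> = svc D (shc D (shc D ?\<alpha> ?\<beta>) ?w) (svc D (shc D (iv D ?F') ?\<psi>') (shc D ?\<phi>' (iv D ?G')))"
    unfolding 2 by (simp add: simps)
  finally show ?thesis
    by (simp add: map_sel)
qed

lemma endo_square_svc:
  assumes s: "framed_by_endo_maps s" "endo_square D s"
    and s': "framed_by_endo_maps s'" "endo_square D s'"
    and *: "fbot s = ftop s'"
  shows "svc D (hcell (ftop s)) (shc D (svc D (vsqr (flft s)) (vsqr (flft s'))) (svc D (fcell s) (fcell s'))) =
         svc D (shc D (svc D (fcell s) (fcell s')) (svc D (vsqr (frgt s)) (vsqr (frgt s')))) (hcell (fbot s'))"
proof -
  \<comment> \<open>The corner rules rewrite the ends of horizontal maps into those of vertical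
    maps. Composability of the vertical sides is therefore not found by rewriting and has to be read
    off from the common horizontal map first.\<close>
  have src: "vtgt (flft s) = vsrc (flft s')" "vtgt (frgt s) = vsrc (frgt s')"
    using framed_by_endo_maps(7,8)[OF s(1)] framed_by_endo_maps(5,6)[OF s'(1)] * by simp_all
  note simps = framed_by_endo_maps[OF s(1)] framed_by_endo_maps[OF s'(1)] src * endo sqr Cell2
  let ?\<alpha> = "fcell s" and ?\<beta> = "fcell s'"
  let ?u = "vsqr (flft s)" and ?u' = "vsqr (flft s')" and ?v = "vsqr (frgt s)" and ?v' = "vsqr (frgt s')"
  let ?\<phi> = "hcell (ftop s)" and ?\<phi>' = "hcell (ftop s')" and ?\<phi>'' = "hcell (fbot s')"
  have eqs: "svc D ?\<phi> (shc D ?u ?\<alpha>) = svc D (shc D ?\<alpha> ?v) ?\<phi>'"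
    "svc D ?\<phi>' (shc D ?u' ?\<beta>) = svc D (shc D ?\<beta> ?v') ?\<phi>''"
    using s s' * by (simp_all add: endo_square_def)
  have "svc D ?\<phi> (shc D (svc D ?u ?u') (svc D ?\<alpha> ?\<beta>)) = svc D (svc D ?\<phi> (shc D ?u ?\<alpha>)) (shc D ?u' ?\<beta>)"
    by (subst interchange[symmetric]) (simp_all add: simps)
  also have "\<dots> = svc D (shc D ?\<alpha> ?v) (svc D ?\<phi>' (shc D ?u' ?\<beta>))"
    unfolding eqs(1) by (simp add: simps)
  also have "\<dots> = svc D (svc D (shc D ?\<alpha> ?v) (shc D ?\<beta> ?v')) ?\<phi>''"
    unfolding eqs(2) by (simp add: simps)
  also have "\<dots> = svc D (shc D (svc D ?\<alpha> ?\<beta>) (svc D ?v ?v')) ?\<phi>''"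
    by (subst interchange) (simp_all add: simps)
  finally show ?thesis .
qed

end

section \<open>Double categories of endomorphisms with a chosen class of maps\<close>

locale endo_system = dblcat D
  for D :: "('o, 'h, 'v, 's) dblcat" +
  fixes Es :: "('o, 'h, 'z) endo_scheme set"
    and Hs :: "(('o, 'h, 'z) endo_scheme, 'h, 's) hmap set"
    and Vs :: "(('o, 'h, 'z) endo_scheme, 'v, 's) vmap set"
  assumes endomorphism_Es: "E \<in> Es \<Longrightarrow> endomorphism D E"
    and Hs: "m \<in> Hs \<Longrightarrow> endo_hmap D m" "m \<in> Hs \<Longrightarrow> hsrc m \<in> Es" "m \<in> Hs \<Longrightarrow> htgt m \<in> Es"
    and Vs: "j \<in> Vs \<Longrightarrow> endo_vmap D j" "j \<in> Vs \<Longrightarrow> vsrc j \<in> Es" "j \<in> Vs \<Longrightarrow> vtgt j \<in> Es"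
    and hmap_id_Hs: "E \<in> Es \<Longrightarrow> hmap_id D E \<in> Hs"
    and hmap_comp_Hs: "\<lbrakk>m \<in> Hs; n \<in> Hs; htgt m = hsrc n\<rbrakk> \<Longrightarrow> hmap_comp D m n \<in> Hs"
    and vmap_id_Vs: "E \<in> Es \<Longrightarrow> vmap_id D E \<in> Vs"
    and vmap_comp_Vs: "\<lbrakk>j \<in> Vs; k \<in> Vs; vtgt j = vsrc k\<rbrakk> \<Longrightarrow> vmap_comp D j k \<in> Vs"
begin

lemmas closed = endomorphism_Es Hs Vs hmap_id_Hs hmap_comp_Hs vmap_id_Vs vmap_comp_Vs

abbreviation EE where "EE \<equiv> endo_dblcat D Es Hs Vs"

lemma EE_Sqr:
  "s \<in> Sqr EE \<longleftrightarrow> ftop s \<in> Hs \<and> fbot s \<in> Hs \<and> flft s \<in> Vs \<and> frgt s \<in> Vs \<and> endo_square D s"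
  by (simp add: endo_dblcat_def)

lemma EE_simps:
  "Obj EE = Es" "Hor EE = Hs" "Ver EE = Vs"
  "hdom EE = hsrc" "hcod EE = htgt" "hid EE = hmap_id D" "hcmp EE = hmap_comp D"
  "vdom EE = vsrc" "vcod EE = vtgt" "vid EE = vmap_id D" "vcmp EE = vmap_comp D"
  "stop EE = ftop" "sbot EE = fbot" "slft EE = flft" "srgt EE = frgt"
  "ih EE j = Framed (hmap_id D (vsrc j)) (hmap_id D (vtgt j)) j j (ih D (vmor j))"
  "shc EE s s' = Framed (hmap_comp D (ftop s) (ftop s')) (hmap_comp D (fbot s) (fbot s'))
     (flft s) (frgt s') (shc D (fcell s) (fcell s'))"
  "iv EE m = Framed m m (vmap_id D (hsrc m)) (vmap_id D (htgt m)) (iv D (hmor m))"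
  "svc EE s s' = Framed (ftop s) (fbot s') (vmap_comp D (flft s) (flft s'))
     (vmap_comp D (frgt s) (frgt s')) (svc D (fcell s) (fcell s'))"
  by (simp_all add: endo_dblcat_def)

lemma framed_EE_Sqr: "s \<in> Sqr EE \<Longrightarrow> framed_by_endo_maps s"
  by (auto simp: EE_Sqr framed_by_endo_maps_def endo_square_def closed)

lemma EE_SqrD:
  assumes "s \<in> Sqr EE"
  shows "ftop s \<in> Hs" "fbot s \<in> Hs" "flft s \<in> Vs" "frgt s \<in> Vs" "endo_square D s"
    "hsrc (ftop s) = vsrc (flft s)" "htgt (ftop s) = vsrc (frgt s)"
    "hsrc (fbot s) = vtgt (flft s)" "htgt (fbot s) = vtgt (frgt s)"
    "fcell s \<in> Sqr D" "stop D (fcell s) = hmor (ftop s)" "sbot D (fcell s) = hmor (fbot s)"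
    "slft D (fcell s) = vmor (flft s)" "srgt D (fcell s) = vmor (frgt s)"
  using assms framed_by_endo_maps[OF framed_EE_Sqr[OF assms]] by (simp_all add: EE_Sqr)

text \<open>Closure of the squares is not among the assumptions of \<open>endo_system\<close>. The
  equation of a square involves only endomorphism data, so one proof covers endomorphisms and
  monads.\<close>

lemma EE_Sqr_shc:
  assumes "s \<in> Sqr EE" "s' \<in> Sqr EE" "frgt s = flft s'"
  shows "shc EE s s' \<in> Sqr EE"
proof -
  have "endo_square D (shc EE s s')"
    using endo_square_shc[of s s'] assms unfolding endo_square_def[of D "shc EE s s'"] squares_def
    by (simp add: EE_simps EE_SqrD[OF assms(1)] EE_SqrD[OF assms(2)] framed_EE_Sqr map_sel sqr closed endo)
  then show ?thesis
    using assms by (simp add: EE_Sqr[of "shc EE s s'"]) (simp add: EE_simps EE_SqrD closed)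
qed

lemma EE_Sqr_svc:
  assumes "s \<in> Sqr EE" "s' \<in> Sqr EE" "fbot s = ftop s'"
  shows "svc EE s s' \<in> Sqr EE"
proof -
  have src: "vtgt (flft s) = vsrc (flft s')" "vtgt (frgt s) = vsrc (frgt s')"
    using EE_SqrD(8,9)[OF assms(1)] EE_SqrD(6,7)[OF assms(2)] assms(3) by simp_all
  have "endo_square D (svc EE s s')"
    using endo_square_svc[of s s'] assms src unfolding endo_square_def[of D "svc EE s s'"] squares_def
    by (simp add: EE_simps EE_SqrD[OF assms(1)] EE_SqrD[OF assms(2)] framed_EE_Sqr map_sel sqr closed endo)
  then show ?thesis
    using assms src by (simp add: EE_Sqr[of "svc EE s s'"]) (simp add: EE_simps EE_SqrD closed)
qed

lemma EE_Sqr_ids: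
  "j \<in> Vs \<Longrightarrow> ih EE j \<in> Sqr EE"
  "m \<in> Hs \<Longrightarrow> iv EE m \<in> Sqr EE"
  unfolding EE_Sqr endo_square_def squares_def
  by (simp_all add: EE_simps map_sel sqr closed endo Cell2)

lemma EE_categories:
  "category (hor_cat EE)"
  "category (ver_cat EE)"
  "category (sqr_hcat EE)"
  "category (sqr_vcat EE)"
proof -
  note laws = closed map_sel hmap_category vmap_category
  show "category (hor_cat EE)" "category (ver_cat EE)"
    unfolding category_def double_cat_defs EE_simps(1-11) by (simp_all add: laws)
  show "category (sqr_hcat EE)"
    unfolding category_def double_cat_defs EE_simps(3,14,15)
  proof (intro conjI ballI impI, goal_cases)
    case (6 s s')
    then show ?case by (rule EE_Sqr_shc)
  qed (use EE_Sqr_ids in \<open>auto simp: EE_simps EE_SqrD laws sqr endo intro!: framed.expand\<close>)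
  show "category (sqr_vcat EE)"
    unfolding category_def double_cat_defs EE_simps(2,12,13)
  proof (intro conjI ballI impI, goal_cases)
    case (6 s s')
    then show ?case by (rule EE_Sqr_svc)
  next
    case (11 s s' s'')
    then show ?case
      using EE_SqrD(6-9)[of s] EE_SqrD(6-9)[of s'] EE_SqrD(6-9)[of s'']
      by (auto simp: EE_simps EE_SqrD laws sqr endo intro!: framed.expand)
  qed (use EE_Sqr_ids in \<open>auto simp: EE_simps EE_SqrD laws sqr endo intro!: framed.expand\<close>)
qed

lemma double_category_EE: "double_category EE"
proof -
  note simps = EE_simps EE_SqrD closed map_sel sqr endo
  note cats = EE_categories[unfolded double_cat_defs]
  have f1: "functor_between (sqr_vcat EE) (ver_cat EE) (hdom EE) (slft EE)"
    "functor_between (sqr_vcat EE) (ver_cat EE) (hcod EE) (srgt EE)"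
    using cats unfolding functor_between_def double_cat_defs by (auto simp: simps)
  have f2: "functor_between (sqr_hcat EE) (hor_cat EE) (vdom EE) (stop EE)"
    "functor_between (sqr_hcat EE) (hor_cat EE) (vcod EE) (sbot EE)"
    using cats unfolding functor_between_def double_cat_defs by (auto simp: simps)
  have f3: "functor_between (ver_cat EE) (sqr_vcat EE) (hid EE) (ih EE)"
    using cats EE_Sqr_ids unfolding functor_between_def double_cat_defs by (auto simp: simps)
  have f4: "functor_between (hor_cat EE) (sqr_hcat EE) (vid EE) (iv EE)"
    using cats EE_Sqr_ids unfolding functor_between_def double_cat_defs by (auto simp: simps)
  have "svc EE (shc EE \<alpha> \<beta>) (shc EE \<gamma> \<delta>) = shc EE (svc EE \<alpha> \<gamma>) (svc EE \<beta> \<delta>)"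
    if "\<alpha> \<in> Sqr EE" "\<beta> \<in> Sqr EE" "\<gamma> \<in> Sqr EE" "\<delta> \<in> Sqr EE"
      and "srgt EE \<alpha> = slft EE \<beta>" "srgt EE \<gamma> = slft EE \<delta>"
      and "sbot EE \<alpha> = stop EE \<gamma>" "sbot EE \<beta> = stop EE \<delta>" for \<alpha> \<beta> \<gamma> \<delta>
    using that by (simp add: EE_simps EE_SqrD interchange)
  with f1 f2 f3 f4 show ?thesis
    unfolding double_category_def by blast
qed

end

section \<open>Cofoldings\<close>

locale cofolded = dblcat D
  for D :: "('o, 'h, 'v, 's) dblcat" +
  fixes \<Lambda> :: "('o, 'h, 'v, 's) cofolding_data"
  assumes cofolding: "cofolding D \<Lambda>"
begin

lemma cofolding_functors:
  "functor_between (ver_cat D) (ver_cat (inverse_quintets (horizontal_2cat D))) (Fobj \<Lambda>) (Fver \<Lambda>)"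
  "functor_between (sqr_hcat D) (sqr_hcat (inverse_quintets (horizontal_2cat D))) (Fver \<Lambda>) (Fsqr \<Lambda>)"
  "functor_between (sqr_vcat D) (sqr_vcat (inverse_quintets (horizontal_2cat D))) (Fhor \<Lambda>) (Fsqr \<Lambda>)"
  using cofolding by (simp_all add: cofolding_def double_functor_def)

lemma cofolding_identity:
  "A \<in> Obj D \<Longrightarrow> Fobj \<Lambda> A = A"
  "f \<in> Hor D \<Longrightarrow> Fhor \<Lambda> f = f"
  "\<alpha> \<in> Cell2 (horizontal_2cat D) \<Longrightarrow> cof_cell \<Lambda> \<alpha> = \<alpha>"
  using cofolding by (simp_all add: cofolding_def)

lemma coholonomy:
  "j \<in> Ver D \<Longrightarrow> coholonomy \<Lambda> j \<in> Hor D"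
  "j \<in> Ver D \<Longrightarrow> hdom D (coholonomy \<Lambda> j) = vcod D j"
  "j \<in> Ver D \<Longrightarrow> hcod D (coholonomy \<Lambda> j) = vdom D j"
  "A \<in> Obj D \<Longrightarrow> coholonomy \<Lambda> (vid D A) = hid D A"
  "\<lbrakk>j \<in> Ver D; k \<in> Ver D; vcod D j = vdom D k\<rbrakk> \<Longrightarrow>
     coholonomy \<Lambda> (vcmp D j k) = hcmp D (coholonomy \<Lambda> k) (coholonomy \<Lambda> j)"
  using functor_betweenD[OF cofolding_functors(1), unfolded double_cat_defs inverse_quintets_simps]
  by (simp_all add: cofolding_identity ver)

lemma Fsqr_sides:
  assumes "\<alpha> \<in> Sqr D"
  shows "ftop (Fsqr \<Lambda> \<alpha>) = stop D \<alpha>" "fbot (Fsqr \<Lambda> \<alpha>) = sbot D \<alpha>"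
    and "flft (Fsqr \<Lambda> \<alpha>) = coholonomy \<Lambda> (slft D \<alpha>)" "frgt (Fsqr \<Lambda> \<alpha>) = coholonomy \<Lambda> (srgt D \<alpha>)"
  using assms
    functor_betweenD(1,2)[OF cofolding_functors(2), unfolded double_cat_defs inverse_quintets_simps, OF assms]
    functor_betweenD(1,2)[OF cofolding_functors(3), unfolded double_cat_defs inverse_quintets_simps, OF assms]
  by (simp_all add: cofolding_identity sqr)

lemma cof_cell:
  "\<alpha> \<in> Sqr D \<Longrightarrow> cof_cell \<Lambda> \<alpha> \<in> Cell2 (horizontal_2cat D)"
  "\<alpha> \<in> Sqr D \<Longrightarrow> stop D (cof_cell \<Lambda> \<alpha>) = hcmp D (coholonomy \<Lambda> (slft D \<alpha>)) (stop D \<alpha>)"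
  "\<alpha> \<in> Sqr D \<Longrightarrow> sbot D (cof_cell \<Lambda> \<alpha>) = hcmp D (sbot D \<alpha>) (coholonomy \<Lambda> (srgt D \<alpha>))"
  using functor_betweenD(3)[OF cofolding_functors(2), unfolded double_cat_defs inverse_quintets_simps]
  by (simp_all add: quintet_def Fsqr_sides)

lemma cof_cell_ih: "j \<in> Ver D \<Longrightarrow> cof_cell \<Lambda> (ih D j) = iv D (coholonomy \<Lambda> j)"
  using functor_betweenD(4)[OF cofolding_functors(2), unfolded double_cat_defs inverse_quintets_simps]
  by simp

lemma cof_cell_shc:
  "\<lbrakk>\<alpha> \<in> Sqr D; \<beta> \<in> Sqr D; srgt D \<alpha> = slft D \<beta>\<rbrakk> \<Longrightarrow>
     cof_cell \<Lambda> (shc D \<alpha> \<beta>) =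
     svc D (shc D (cof_cell \<Lambda> \<alpha>) (iv D (stop D \<beta>))) (shc D (iv D (sbot D \<alpha>)) (cof_cell \<Lambda> \<beta>))"
  using functor_betweenD(5)[OF cofolding_functors(2), unfolded double_cat_defs inverse_quintets_simps]
  by (simp add: Fsqr_sides)

lemma cof_cell_svc:
  "\<lbrakk>\<alpha> \<in> Sqr D; \<beta> \<in> Sqr D; sbot D \<alpha> = stop D \<beta>\<rbrakk> \<Longrightarrow>
     cof_cell \<Lambda> (svc D \<alpha> \<beta>) =
     svc D (shc D (iv D (coholonomy \<Lambda> (slft D \<beta>))) (cof_cell \<Lambda> \<alpha>))
       (shc D (cof_cell \<Lambda> \<beta>) (iv D (coholonomy \<Lambda> (srgt D \<alpha>))))"
  using functor_betweenD(5)[OF cofolding_functors(3), unfolded double_cat_defs inverse_quintets_simps]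
  by (simp add: Fsqr_sides)

lemma Fsqr_bij:
  "boundary D f g j k \<Longrightarrow>
     bij_betw (Fsqr \<Lambda>) (squares D f g j k)
       (squares (inverse_quintets (horizontal_2cat D)) f g (coholonomy \<Lambda> j) (coholonomy \<Lambda> k))"
  using cofolding
  by (auto simp: cofolding_def fully_faithful_on_squares_def boundary_def)

text \<open>\<open>Fsqr \<Lambda> \<alpha>\<close> consists of
  \<open>cof_cell \<Lambda> \<alpha>\<close> and four sides that depend only on the boundary of
  \<alpha>. On a fixed boundary, injectivity of \<open>Fsqr \<Lambda>\<close> is thus injectivity of
  \<open>cof_cell \<Lambda>\<close>.\<close>

lemma cof_cell_inj:
  assumes "\<alpha> \<in> squares D f g j k" "\<beta> \<in> squares D f g j k" "cof_cell \<Lambda> \<alpha> = cof_cell \<Lambda> \<beta>"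
  shows "\<alpha> = \<beta>"
proof -
  have "boundary D f g j k"
    using assms(1) by (auto simp: squares_def boundary_def sqr)
  from Fsqr_bij[OF this] have "inj_on (Fsqr \<Lambda>) (squares D f g j k)"
    by (rule bij_betw_imp_inj_on)
  moreover have "Fsqr \<Lambda> \<alpha> = Fsqr \<Lambda> \<beta>"
    using assms by (auto intro!: framed.expand simp: squares_def Fsqr_sides)
  ultimately show ?thesis
    using assms(1,2) by (simp add: inj_on_def)
qed

lemma cof_cell_surj:
  assumes "boundary D f g j k" "a \<in> Cell2 (horizontal_2cat D)"
    and "stop D a = hcmp D (coholonomy \<Lambda> j) f" "sbot D a = hcmp D g (coholonomy \<Lambda> k)"
  obtains \<alpha> where "\<alpha> \<in> squares D f g j k" "cof_cell \<Lambda> \<alpha> = a"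
proof -
  have "Framed f g (coholonomy \<Lambda> j) (coholonomy \<Lambda> k) a \<in>
      squares (inverse_quintets (horizontal_2cat D)) f g (coholonomy \<Lambda> j) (coholonomy \<Lambda> k)"
    using assms unfolding squares_def inverse_quintets_simps
    by (simp add: quintet_def boundary_def coholonomy)
  then obtain \<alpha> where "\<alpha> \<in> squares D f g j k"
    "Fsqr \<Lambda> \<alpha> = Framed f g (coholonomy \<Lambda> j) (coholonomy \<Lambda> k) a"
    using Fsqr_bij[OF assms(1)] unfolding bij_betw_def by (metis (no_types, lifting) imageE)
  then show thesis
    using that by (metis framed.sel(5))
qed

lemmas cof = cofolding_identity coholonomy cof_cell

lemma inherited_coholonomy_sel:
  "hsrc (inherited_coholonomy \<Lambda> m) = vtgt m" "htgt (inherited_coholonomy \<Lambda> m) = vsrc m"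
  "hmor (inherited_coholonomy \<Lambda> m) = coholonomy \<Lambda> (vmor m)"
  "hcell (inherited_coholonomy \<Lambda> m) = cof_cell \<Lambda> (vsqr m)"
  by (simp_all add: inherited_coholonomy_def)

lemma endo_hmap_inherited_coholonomy:
  "endo_vmap D m \<Longrightarrow> endo_hmap D (inherited_coholonomy \<Lambda> m)"
  unfolding endo_hmap_def two_cell_def
  by (simp add: inherited_coholonomy_sel endo cof)

lemma inherited_coholonomy_vmap_id:
  "endomorphism D E \<Longrightarrow> inherited_coholonomy \<Lambda> (vmap_id D E) = hmap_id D E"
  by (rule hmap.expand) (simp add: inherited_coholonomy_sel map_sel endo cof Cell2)

text \<open>The vertical pasting of quintets in \<open>cof_cell_svc\<close> is literally the cell of
  a composite in \<open>hmap_comp\<close>, with the lower map first.\<close>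

lemma inherited_coholonomy_vmap_comp:
  "\<lbrakk>endo_vmap D m; endo_vmap D n; vtgt m = vsrc n\<rbrakk> \<Longrightarrow>
     inherited_coholonomy \<Lambda> (vmap_comp D m n) =
     hmap_comp D (inherited_coholonomy \<Lambda> n) (inherited_coholonomy \<Lambda> m)"
  by (rule hmap.expand) (simp add: inherited_coholonomy_sel map_sel endo cof cof_cell_svc)

text \<open>The inner frame in \<open>inherited_cofolding\<close>: the candidate 2-cell between
  composite maps. It gets a name of its own because it makes sense before the equation of
  \<open>s\<close> is known.\<close>

definition inherited_cell ::
  "(('o, 'h, 'z) endo_scheme, 'h, 'v, 's) esquare \<Rightarrow>
   (('o, 'h, 'z) endo_scheme, 'h, 'v, 's) esquare" where
  "inherited_cell s =
     Framed (hmap_comp D (inherited_coholonomy \<Lambda> (flft s)) (ftop s))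
       (hmap_comp D (fbot s) (inherited_coholonomy \<Lambda> (frgt s)))
       (vmap_id D (hsrc (fbot s))) (vmap_id D (htgt (ftop s))) (cof_cell \<Lambda> (fcell s))"

text \<open>In \<open>1\<close> and \<open>2\<close> the cells \<phi> and \<phi>' are fixed by
  \<Lambda>, and their vertical sides are identities, so the whiskerings with the coholonomies of
  those sides vanish. What remains next to \<open>cof_cell \<Lambda> ?\<alpha>\<close> is the cell
  of the composite map \<open>?t\<close> or \<open>?b\<close>. The squares \<open>?P'\<close> and
  \<open>?Q\<close> are those of the identity vertical maps that frame
  \<open>inherited_cell s\<close>.\<close>

lemma endo_square_inherited_cell:
  assumes "framed_by_endo_maps s"
  shows "endo_square D (inherited_cell s) \<longleftrightarrow> endo_square D s"
proof -
  note simps = framed_by_endo_maps[OF assms] endo sqr Cell2 cof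
  let ?\<alpha> = "fcell s" and ?u = "vsqr (flft s)" and ?v = "vsqr (frgt s)"
  let ?F = "hmor (ftop s)" and ?F' = "hmor (fbot s)"
  let ?\<phi> = "hcell (ftop s)" and ?\<phi>' = "hcell (fbot s)"
  let ?t = "hmap_comp D (inherited_coholonomy \<Lambda> (flft s)) (ftop s)"
  let ?b = "hmap_comp D (fbot s) (inherited_coholonomy \<Lambda> (frgt s))"
  let ?P' = "iv D (emor (vtgt (flft s)))" and ?Q = "iv D (emor (vsrc (frgt s)))"
  have 1: "cof_cell \<Lambda> (svc D ?\<phi> (shc D ?u ?\<alpha>)) = svc D (hcell ?t) (shc D ?P' (cof_cell \<Lambda> ?\<alpha>))"
    by (simp add: simps cof_cell_svc cof_cell_shc map_sel inherited_coholonomy_sel)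
  have 2: "cof_cell \<Lambda> (svc D (shc D ?\<alpha> ?v) ?\<phi>') = svc D (shc D (cof_cell \<Lambda> ?\<alpha>) ?Q) (hcell ?b)"
    by (simp add: simps cof_cell_svc cof_cell_shc map_sel inherited_coholonomy_sel)
  \<comment> \<open>Injectivity of \<open>cof_cell\<close> holds for squares with a common boundary;
    this is the boundary shared by the two sides of the equation of \<open>s\<close>.\<close>
  let ?S = "squares D (hcmp D ?F (emor (vsrc (frgt s)))) (hcmp D (emor (vtgt (flft s))) ?F')
      (vmor (flft s)) (vmor (frgt s))"
  have "svc D ?\<phi> (shc D ?u ?\<alpha>) \<in> ?S" "svc D (shc D ?\<alpha> ?v) ?\<phi>' \<in> ?S"
    by (simp_all add: squares_def simps)
  then have "endo_square D s \<longleftrightarrow>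
      svc D (hcell ?t) (shc D ?P' (cof_cell \<Lambda> ?\<alpha>)) = svc D (shc D (cof_cell \<Lambda> ?\<alpha>) ?Q) (hcell ?b)"
    unfolding endo_square_iff[OF assms] 1[symmetric] 2[symmetric] using cof_cell_inj by metis
  then show ?thesis
    unfolding endo_square_def[of D "inherited_cell s"] squares_def
    by (simp add: simps map_sel inherited_coholonomy_sel inherited_cell_def)
qed

end

section \<open>The inherited cofolding on such a double category\<close>

locale cofolded_endo_system = cofolded D \<Lambda> + endo_system D Es Hs Vs
  for D :: "('o, 'h, 'v, 's) dblcat" and \<Lambda> :: "('o, 'h, 'v, 's) cofolding_data"
    and Es :: "('o, 'h, 'z) endo_scheme set"
    and Hs :: "(('o, 'h, 'z) endo_scheme, 'h, 's) hmap set"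
    and Vs :: "(('o, 'h, 'z) endo_scheme, 'v, 's) vmap set" +
  assumes inherited_Hs: "m \<in> Vs \<Longrightarrow> inherited_coholonomy \<Lambda> m \<in> Hs"
begin

text \<open>The general theory is now applied to \<open>EE\<close> in place of \<open>D\<close>,
  which yields the quintets in which the inherited cofolding takes its values.\<close>

sublocale EE: dblcat EE
  by (rule dblcat.intro[OF double_category_EE])

lemma EE_Cell2:
  "s \<in> Cell2 (horizontal_2cat EE) \<longleftrightarrow>
     s \<in> Sqr EE \<and> flft s = vmap_id D (hsrc (ftop s)) \<and> frgt s = vmap_id D (htgt (ftop s))"
  unfolding EE.Cell2_iff EE_simps by simp

abbreviation IC where "IC \<equiv> inherited_cofolding D \<Lambda>"

lemma IC_simps:
  "Fobj IC E = E" "Fhor IC m = m" "Fver IC j = inherited_coholonomy \<Lambda> j"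
  "Fsqr IC s = Framed (ftop s) (fbot s) (inherited_coholonomy \<Lambda> (flft s))
     (inherited_coholonomy \<Lambda> (frgt s)) (inherited_cell s)"
  by (simp_all add: inherited_cofolding_def inherited_cell_def Let_def)

lemmas system = closed inherited_Hs map_sel inherited_coholonomy_sel

lemma inherited_cell_Cell2:
  assumes "s \<in> Sqr EE"
  shows "inherited_cell s \<in> Cell2 (horizontal_2cat EE)"
proof -
  have "endo_square D (inherited_cell s)"
    using assms endo_square_inherited_cell[OF framed_EE_Sqr[OF assms]] by (simp add: EE_Sqr)
  then show ?thesis
    using EE_SqrD[OF assms] unfolding EE_Cell2 EE_Sqr
    by (simp add: inherited_cell_def system)
qed

lemma quintet_Fsqr:
  assumes "s \<in> Sqr EE"
  shows "EE.quintet (ftop s) (fbot s) (inherited_coholonomy \<Lambda> (flft s))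
     (inherited_coholonomy \<Lambda> (frgt s)) (inherited_cell s)"
  using EE_SqrD[OF assms] inherited_cell_Cell2[OF assms]
  unfolding EE.quintet_def EE_simps by (simp add: system inherited_cell_def)

text \<open>The underlying cells agree by \<open>cof_cell_shc\<close>. The frames agree by
  associativity of \<open>hmap_comp\<close> and because the composite of two identity vertical maps
  is an identity.\<close>

lemma inherited_cell_shc:
  assumes "s \<in> Sqr EE" "s' \<in> Sqr EE" "frgt s = flft s'"
  shows "inherited_cell (shc EE s s') =
     svc EE (shc EE (inherited_cell s) (iv EE (ftop s'))) (shc EE (iv EE (fbot s)) (inherited_cell s'))"
  using EE_SqrD[OF assms(1)] EE_SqrD[OF assms(2)] assms(3)
  by (simp add: inherited_cell_def EE_simps system cof_cell_shc hmap_category vmap_category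
      endo_hmap_inherited_coholonomy)

lemma inherited_cell_svc:
  assumes "s \<in> Sqr EE" "s' \<in> Sqr EE" "fbot s = ftop s'"
  shows "inherited_cell (svc EE s s') =
     svc EE (shc EE (iv EE (inherited_coholonomy \<Lambda> (flft s'))) (inherited_cell s))
       (shc EE (inherited_cell s') (iv EE (inherited_coholonomy \<Lambda> (frgt s))))"
proof -
  have "vtgt (flft s) = vsrc (flft s')" "vtgt (frgt s) = vsrc (frgt s')"
    using EE_SqrD(8,9)[OF assms(1)] EE_SqrD(6,7)[OF assms(2)] assms(3) by simp_all
  then show ?thesis
    using EE_SqrD[OF assms(1)] EE_SqrD[OF assms(2)] assms(3)
    by (simp add: inherited_cell_def EE_simps system cof_cell_svc hmap_category vmap_category
        endo_hmap_inherited_coholonomy inherited_coholonomy_vmap_comp)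
qed

lemma inherited_cell_ids:
  "j \<in> Vs \<Longrightarrow> inherited_cell (ih EE j) = iv EE (inherited_coholonomy \<Lambda> j)"
  "m \<in> Hs \<Longrightarrow> inherited_cell (iv EE m) = iv EE m"
  by (simp_all add: inherited_cell_def EE_simps system endo cof cof_cell_ih hmap_category Cell2
      endo_hmap_inherited_coholonomy inherited_coholonomy_vmap_id)

lemma Fsqr_IC_bij:
  assumes "boundary EE f g j k"
  shows "bij_betw (Fsqr IC) (squares EE f g j k)
     (squares (inverse_quintets (horizontal_2cat EE)) f g
       (inherited_coholonomy \<Lambda> j) (inherited_coholonomy \<Lambda> k))"
proof (rule bij_betw_imageI)
  have bd: "f \<in> Hs" "g \<in> Hs" "j \<in> Vs" "k \<in> Vs" "hsrc f = vsrc j" "htgt f = vsrc k"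
    "hsrc g = vtgt j" "htgt g = vtgt k"
    using assms by (simp_all add: boundary_def EE_simps)
  let ?T = "squares (inverse_quintets (horizontal_2cat EE)) f g
       (inherited_coholonomy \<Lambda> j) (inherited_coholonomy \<Lambda> k)"
  show "inj_on (Fsqr IC) (squares EE f g j k)"
  proof (rule inj_onI)
    fix s s' assume s: "s \<in> squares EE f g j k" "s' \<in> squares EE f g j k" "Fsqr IC s = Fsqr IC s'"
    then have "cof_cell \<Lambda> (fcell s) = cof_cell \<Lambda> (fcell s')"
      by (simp add: IC_simps inherited_cell_def)
    moreover have "fcell s \<in> squares D (hmor f) (hmor g) (vmor j) (vmor k)"
      "fcell s' \<in> squares D (hmor f) (hmor g) (vmor j) (vmor k)"
      using s(1,2) by (auto simp: squares_def EE_simps EE_SqrD)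
    ultimately have "fcell s = fcell s'"
      using cof_cell_inj by blast
    with s(1,2) show "s = s'"
      by (intro framed.expand) (simp add: squares_def EE_simps)
  qed
  show "Fsqr IC ` squares EE f g j k = ?T"
  proof (rule set_eqI, rule iffI)
    fix q assume "q \<in> Fsqr IC ` squares EE f g j k"
    then show "q \<in> ?T"
      using quintet_Fsqr by (auto simp: squares_def EE.inverse_quintets_simps IC_simps) (auto simp: EE_simps)
  next
    fix q assume "q \<in> ?T"
    then have q: "ftop q = f" "fbot q = g" "flft q = inherited_coholonomy \<Lambda> j"
      "frgt q = inherited_coholonomy \<Lambda> k"
      and qc: "fcell q \<in> Cell2 (horizontal_2cat EE)"
      "ftop (fcell q) = hmap_comp D (inherited_coholonomy \<Lambda> j) f"
      "fbot (fcell q) = hmap_comp D g (inherited_coholonomy \<Lambda> k)"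
      unfolding squares_def EE.inverse_quintets_simps EE.quintet_def by (auto simp: EE_simps)
    let ?c = "fcell (fcell q)"
    have c: "fcell q \<in> Sqr EE" "flft (fcell q) = vmap_id D (vtgt j)" "frgt (fcell q) = vmap_id D (vsrc k)"
      using qc bd by (auto simp: EE_Cell2 system)
    note c' = EE_SqrD[OF c(1)]
    \<comment> \<open>The vertical maps framing \<open>fcell q\<close> are identities, so the square
      underlying it is a 2-cell of \<open>D\<close> and has a preimage under
      \<open>cof_cell \<Lambda>\<close>.\<close>
    have "?c \<in> Cell2 (horizontal_2cat D)"
      "stop D ?c = hcmp D (coholonomy \<Lambda> (vmor j)) (hmor f)"
      "sbot D ?c = hcmp D (hmor g) (coholonomy \<Lambda> (vmor k))"
      using c c' bd qc by (simp_all add: Cell2_iff system endo sqr coholonomy)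
    moreover have "boundary D (hmor f) (hmor g) (vmor j) (vmor k)"
      using bd by (simp add: boundary_def closed endo)
    ultimately obtain \<alpha> where \<alpha>: "\<alpha> \<in> squares D (hmor f) (hmor g) (vmor j) (vmor k)" "cof_cell \<Lambda> \<alpha> = ?c"
      by (metis cof_cell_surj)
    let ?s = "Framed f g j k \<alpha>"
    have ic: "inherited_cell ?s = fcell q"
      using \<alpha> c qc bd by (intro framed.expand) (simp add: inherited_cell_def)
    have "framed_by_endo_maps ?s"
      using bd \<alpha> by (simp add: framed_by_endo_maps_def closed)
    \<comment> \<open>The preimage comes without its equation. The image \<open>fcell q\<close> is a
      square of \<open>EE\<close>, and \<open>endo_square_inherited_cell\<close> carries its
      equation back.\<close>
    then have "endo_square D ?s"
      using endo_square_inherited_cell c'(5) ic by metis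
    then have "?s \<in> squares EE f g j k"
      using bd unfolding squares_def by (simp add: EE_Sqr EE_simps(12-15))
    moreover have "Fsqr IC ?s = q"
      using q ic by (intro framed.expand) (simp add: IC_simps)
    ultimately show "q \<in> Fsqr IC ` squares EE f g j k"
      by blast
  qed
qed

theorem cofolding_EE: "cofolding EE IC"
proof -
  let ?Q = "inverse_quintets (horizontal_2cat EE)"
  have h: "functor_between (hor_cat EE) (hor_cat ?Q) (Fobj IC) (Fhor IC)"
  proof (rule functor_betweenI[OF EE_categories(1) EE.category_inverse_quintets(1)],
      unfold double_cat_defs EE.inverse_quintets_simps)
  qed (simp_all add: IC_simps)
  have v: "functor_between (ver_cat EE) (ver_cat ?Q) (Fobj IC) (Fver IC)"
  proof (rule functor_betweenI[OF EE_categories(2) EE.category_inverse_quintets(2)],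
      unfold double_cat_defs EE.inverse_quintets_simps)
  qed (simp_all add: IC_simps EE_simps system inherited_coholonomy_vmap_id inherited_coholonomy_vmap_comp)
  have sh: "functor_between (sqr_hcat EE) (sqr_hcat ?Q) (Fver IC) (Fsqr IC)"
  proof (rule functor_betweenI[OF EE_categories(3) EE.category_inverse_quintets(3)],
      unfold double_cat_defs EE.inverse_quintets_simps, goal_cases)
    case (2 s)
    then show ?case
      by (simp add: IC_simps quintet_Fsqr) (simp add: EE_simps)
  next
    case (3 j)
    then show ?case
      \<comment> \<open>The identity square stays folded in this pass, since
        \<open>inherited_cell_ids\<close> has to recognise it.\<close>
      by (simp add: IC_simps EE_simps(1-3) inherited_cell_ids)
        (simp add: EE_simps system)
  next
    case (4 s s')
    then show ?case
      by (simp add: IC_simps EE_simps(12-15) inherited_cell_shc)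
        (simp add: EE_simps EE_SqrD system)
  qed (simp add: IC_simps EE_simps system)
  have sv: "functor_between (sqr_vcat EE) (sqr_vcat ?Q) (Fhor IC) (Fsqr IC)"
  proof (rule functor_betweenI[OF EE_categories(4) EE.category_inverse_quintets(4)],
      unfold double_cat_defs EE.inverse_quintets_simps, goal_cases)
    case (2 s)
    then show ?case
      by (simp add: IC_simps quintet_Fsqr) (simp add: EE_simps)
  next
    case (3 j)
    then show ?case
      by (simp add: IC_simps EE_simps(1-3) inherited_cell_ids)
        (simp add: EE_simps system closed endo inherited_coholonomy_vmap_id)
  next
    case (4 s s')
    then have "vtgt (flft s) = vsrc (flft s')" "vtgt (frgt s) = vsrc (frgt s')"
      using EE_SqrD(8,9)[of s] EE_SqrD(6,7)[of s'] by (simp_all add: EE_simps)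
    with 4 show ?case
      by (simp add: IC_simps EE_simps(12-15) inherited_cell_svc)
        (simp add: EE_simps EE_SqrD system inherited_coholonomy_vmap_comp)
  qed (simp add: IC_simps EE_simps system)
  \<comment> \<open>When the vertical sides are identities, so are their coholonomies; these drop
    out of the composite maps in the frame, and \<Lambda> fixes the underlying 2-cell.\<close>
  have "cof_cell IC s = s" if "s \<in> Cell2 (horizontal_2cat EE)" for s
  proof -
    have s: "s \<in> Sqr EE" "flft s = vmap_id D (hsrc (ftop s))" "frgt s = vmap_id D (htgt (ftop s))"
      using that by (simp_all add: EE_Cell2)
    let ?X = "hsrc (ftop s)" and ?Y = "htgt (ftop s)"
    note s' = EE_SqrD(1,2,10-14)[OF s(1)]
    have bot: "hsrc (fbot s) = ?X" "htgt (fbot s) = ?Y"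
      using EE_SqrD(8,9)[OF s(1)] by (simp_all add: s(2,3) map_sel)
    have "fcell s \<in> Cell2 (horizontal_2cat D)"
      using s s' by (simp add: Cell2_iff system endo)
    then show ?thesis
      using s s' bot unfolding IC_simps framed.sel inherited_cell_def
      by (intro framed.expand) (simp add: system endo cof hmap_category inherited_coholonomy_vmap_id)
  qed
  with h v sh sv show ?thesis
    unfolding cofolding_def double_functor_def fully_faithful_on_squares_def
    using double_category_EE EE.double_category_inverse_quintets Fsqr_IC_bij
    by (simp add: IC_simps)
qed

end

section \<open>Monads\<close>

context dblcat
begin

lemma monad:
  assumes "is_monad D M"
  shows "endomorphism D M"
    and "mult M \<in> Cell2 (horizontal_2cat D)" "unit_cell M \<in> Cell2 (horizontal_2cat D)"
    and "stop D (mult M) = hcmp D (emor M) (emor M)" "sbot D (mult M) = emor M"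
    and "stop D (unit_cell M) = hid D (base M)" "sbot D (unit_cell M) = emor M"
  using assms by (simp_all add: is_monad_def two_cell_def Let_def)

lemma monad_hmap:
  assumes "monad_hmap D m"
  shows "is_monad D (hsrc m)" "is_monad D (htgt m)" "endo_hmap D m"
    and "svc D (shc D (iv D (hmor m)) (unit_cell (htgt m))) (hcell m) =
      shc D (unit_cell (hsrc m)) (iv D (hmor m))"
    and "svc D (shc D (iv D (hmor m)) (mult (htgt m))) (hcell m) =
      svc D (svc D (shc D (hcell m) (iv D (emor (htgt m)))) (shc D (iv D (emor (hsrc m))) (hcell m)))
        (shc D (mult (hsrc m)) (iv D (hmor m)))"
  using assms by (simp_all add: monad_hmap_def Let_def)

lemma monad_vmap:
  assumes "monad_vmap D m"
  shows "is_monad D (vsrc m)" "is_monad D (vtgt m)" "endo_vmap D m"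
    and "svc D (unit_cell (vsrc m)) (vsqr m) = svc D (ih D (vmor m)) (unit_cell (vtgt m))"
    and "svc D (mult (vsrc m)) (vsqr m) = svc D (shc D (vsqr m) (vsqr m)) (mult (vtgt m))"
  using assms by (simp_all add: monad_vmap_def)

lemma monad_hmap_id: "is_monad D M \<Longrightarrow> monad_hmap D (hmap_id D M)"
  unfolding monad_hmap_def Let_def
  by (simp add: endo_hmap_id monad map_sel endo pasting Cell2)

lemma monad_vmap_id: "is_monad D M \<Longrightarrow> monad_vmap D (vmap_id D M)"
  unfolding monad_vmap_def
  \<comment> \<open>The law for the unit contains \<open>ih D (vid D (base M))\<close>, whereas the
    unit laws in \<open>pasting\<close> are stated for \<open>iv\<close>; the reversed rule
    translates.\<close>
  by (simp add: endo_vmap_id monad map_sel endo pasting Cell2 flip: sqr_ids(3))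

text \<open>Inserting the multiplication law of \<open>n\<close> and then that of \<open>m\<close>
  produces the cells in the order \<psi>, \<psi>, \<phi>, \<phi>. Two copies of the composite cell
  require \<psi>, \<phi>, \<psi>, \<phi>. The middle two act on the disjoint factors
  \<open>[G R]\<close> and \<open>[F Q]\<close>, so they can be exchanged.\<close>

lemma monad_hmap_comp:
  assumes m: "monad_hmap D m" and n: "monad_hmap D n" and *: "htgt m = hsrc n"
  shows "monad_hmap D (hmap_comp D m n)"
proof -
  let ?F = "hmor m" and ?G = "hmor n" and ?\<phi> = "hcell m" and ?\<psi> = "hcell n"
  let ?P = "emor (hsrc m)" and ?Q = "emor (hsrc n)" and ?R = "emor (htgt n)"
  note simps = monad_hmap(1-3)[OF m] monad_hmap(1-3)[OF n] * monad endo pasting Cell2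
  note m_eqs = monad_hmap(4,5)[OF m, unfolded *] and n_eqs = monad_hmap(4,5)[OF n]
  let ?\<eta>P = "unit_cell (hsrc m)" and ?\<eta>Q = "unit_cell (hsrc n)" and ?\<eta>R = "unit_cell (htgt n)"
  let ?\<mu>P = "mult (hsrc m)" and ?\<mu>Q = "mult (hsrc n)" and ?\<mu>R = "mult (htgt n)"
  \<comment> \<open>The intermediate terms are bracketed so that the left-hand side of the next
    monad map law occurs in them literally; the normal form would break it up.\<close>
  have "svc D (shc D (iv D (hcmp D ?F ?G)) ?\<eta>R) (svc D (shc D (iv D ?F) ?\<psi>) (shc D ?\<phi> (iv D ?G))) =
      svc D (shc D (iv D ?F) (svc D (shc D (iv D ?G) ?\<eta>R) ?\<psi>)) (shc D ?\<phi> (iv D ?G))"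
    by (simp add: simps)
  also have "\<dots> = shc D (svc D (shc D (iv D ?F) ?\<eta>Q) ?\<phi>) (iv D ?G)"
    unfolding n_eqs by (simp add: simps)
  also have "\<dots> = shc D ?\<eta>P (iv D (hcmp D ?F ?G))"
    unfolding m_eqs by (simp add: simps)
  finally have unit: "svc D (shc D (iv D (hcmp D ?F ?G)) ?\<eta>R)
      (svc D (shc D (iv D ?F) ?\<psi>) (shc D ?\<phi> (iv D ?G))) = shc D ?\<eta>P (iv D (hcmp D ?F ?G))" .
  have "svc D (shc D (iv D (hcmp D ?F ?G)) ?\<mu>R) (svc D (shc D (iv D ?F) ?\<psi>) (shc D ?\<phi> (iv D ?G))) =
      svc D (shc D (iv D ?F) (svc D (shc D (iv D ?G) ?\<mu>R) ?\<psi>)) (shc D ?\<phi> (iv D ?G))"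
    by (simp add: simps)
  also have "\<dots> = svc D (shc D (iv D ?F) (svc D (shc D ?\<psi> (iv D ?R)) (shc D (iv D ?Q) ?\<psi>)))
      (shc D (svc D (shc D (iv D ?F) ?\<mu>Q) ?\<phi>) (iv D ?G))"
    unfolding n_eqs by (simp add: simps)
  also have "\<dots> = svc D (shc D (iv D ?F) (shc D ?\<psi> (iv D ?R)))
      (svc D (shc D (iv D (hcmp D ?F ?Q)) ?\<psi>) (svc D (shc D ?\<phi> (iv D (hcmp D ?Q ?G)))
        (svc D (shc D (iv D ?P) (shc D ?\<phi> (iv D ?G))) (shc D ?\<mu>P (iv D (hcmp D ?F ?G))))))"
    unfolding m_eqs by (simp add: simps)
  also have "\<dots> = svc D (shc D (iv D ?F) (shc D ?\<psi> (iv D ?R)))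
      (svc D (shc D ?\<phi> (iv D (hcmp D ?G ?R))) (svc D (shc D (iv D (hcmp D ?P ?F)) ?\<psi>)
        (svc D (shc D (iv D ?P) (shc D ?\<phi> (iv D ?G))) (shc D ?\<mu>P (iv D (hcmp D ?F ?G))))))"
    by (subst exchange_tail) (simp_all add: simps)
  finally have "svc D (shc D (iv D (hcmp D ?F ?G)) ?\<mu>R) (svc D (shc D (iv D ?F) ?\<psi>) (shc D ?\<phi> (iv D ?G))) =
      svc D (shc D (iv D ?F) (shc D ?\<psi> (iv D ?R)))
      (svc D (shc D ?\<phi> (iv D (hcmp D ?G ?R))) (svc D (shc D (iv D (hcmp D ?P ?F)) ?\<psi>)
        (svc D (shc D (iv D ?P) (shc D ?\<phi> (iv D ?G))) (shc D ?\<mu>P (iv D (hcmp D ?F ?G))))))" .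
  with unit show ?thesis
    unfolding monad_hmap_def Let_def by (simp add: simps endo_hmap_comp map_sel)
qed

lemma monad_vmap_comp:
  assumes m: "monad_vmap D m" and n: "monad_vmap D n" and *: "vtgt m = vsrc n"
  shows "monad_vmap D (vmap_comp D m n)"
proof -
  let ?u = "vsqr m" and ?v = "vsqr n"
  note simps = monad_vmap(1-3)[OF m] monad_vmap(1-3)[OF n] * monad endo sqr Cell2
  note m_eqs = monad_vmap(4,5)[OF m, unfolded *] and n_eqs = monad_vmap(4,5)[OF n]
  have "svc D (unit_cell (vsrc m)) (svc D ?u ?v) = svc D (svc D (unit_cell (vsrc m)) ?u) ?v"
    by (simp add: simps)
  also have "\<dots> = svc D (ih D (vmor m)) (svc D (unit_cell (vsrc n)) ?v)"
    unfolding m_eqs by (simp add: simps)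
  also have "\<dots> = svc D (svc D (ih D (vmor m)) (ih D (vmor n))) (unit_cell (vtgt n))"
    \<comment> \<open>Reassociation precedes simplification here, because \<open>sqr_ids\<close>
      would otherwise fuse the two identity squares on the right-hand side only.\<close>
    unfolding n_eqs by (subst sqr_ver(11)) (simp_all add: simps)
  finally have unit: "svc D (unit_cell (vsrc m)) (svc D ?u ?v) =
      svc D (ih D (vcmp D (vmor m) (vmor n))) (unit_cell (vtgt n))"
    by (simp add: simps)
  have "svc D (mult (vsrc m)) (svc D ?u ?v) = svc D (svc D (mult (vsrc m)) ?u) ?v"
    by (simp add: simps)
  also have "\<dots> = svc D (shc D ?u ?u) (svc D (mult (vsrc n)) ?v)"
    unfolding m_eqs by (simp add: simps)
  also have "\<dots> = svc D (svc D (shc D ?u ?u) (shc D ?v ?v)) (mult (vtgt n))"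
    unfolding n_eqs by (simp add: simps)
  also have "\<dots> = svc D (shc D (svc D ?u ?v) (svc D ?u ?v)) (mult (vtgt n))"
    by (subst interchange) (simp_all add: simps)
  finally show ?thesis
    using unit unfolding monad_vmap_def by (simp add: simps endo_vmap_comp map_sel)
qed

lemma endo_system_End: "endo_system D {E. endomorphism D E} {m. endo_hmap D m} {j. endo_vmap D j}"
  by unfold_locales (simp_all add: endo endo_hmap_id endo_vmap_id endo_hmap_comp endo_vmap_comp)

lemma endo_system_Mnd: "endo_system D {M. is_monad D M} {m. monad_hmap D m} {j. monad_vmap D j}"
  by unfold_locales
    (simp_all add: monad_hmap monad_vmap monad(1) monad_hmap_id monad_vmap_id monad_hmap_comp
      monad_vmap_comp)

end

context cofolded
begin

lemma monad_hmap_inherited_coholonomy: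
  assumes "monad_vmap D m"
  shows "monad_hmap D (inherited_coholonomy \<Lambda> m)"
proof -
  note simps = monad_vmap(1-3)[OF assms] monad endo sqr Cell2 cof
  note eqs = monad_vmap(4,5)[OF assms, THEN arg_cong[where f = "cof_cell \<Lambda>"]]
  \<comment> \<open>Coholonomy reverses direction, so the monad \<open>vsrc m\<close> now plays the
    part of the target. The identity sides of units and multiplications again make their whiskerings
    trivial, and \<open>ih\<close> becomes \<open>iv\<close> of the coholonomy.\<close>
  have "svc D (shc D (iv D (coholonomy \<Lambda> (vmor m))) (unit_cell (vsrc m))) (cof_cell \<Lambda> (vsqr m)) =
      shc D (unit_cell (vtgt m)) (iv D (coholonomy \<Lambda> (vmor m)))"
    using eqs(1) by (simp add: simps cof_cell_svc cof_cell_ih)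
  moreover have "svc D (shc D (iv D (coholonomy \<Lambda> (vmor m))) (mult (vsrc m))) (cof_cell \<Lambda> (vsqr m)) =
      svc D (svc D (shc D (cof_cell \<Lambda> (vsqr m)) (iv D (emor (vsrc m))))
        (shc D (iv D (emor (vtgt m))) (cof_cell \<Lambda> (vsqr m))))
        (shc D (mult (vtgt m)) (iv D (coholonomy \<Lambda> (vmor m))))"
    using eqs(2) by (simp add: simps cof_cell_svc cof_cell_shc)
  ultimately show ?thesis
    unfolding monad_hmap_def Let_def
    by (simp add: simps endo_hmap_inherited_coholonomy inherited_coholonomy_sel)
qed

lemma cofolded_End:
  "cofolded_endo_system D \<Lambda> {E. endomorphism D E} {m. endo_hmap D m} {j. endo_vmap D j}"
  by (intro cofolded_endo_system.intro cofolded_endo_system_axioms.intro endo_system_End)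
    (simp_all add: cofolded_axioms endo_hmap_inherited_coholonomy)

lemma cofolded_Mnd:
  "cofolded_endo_system D \<Lambda> {M. is_monad D M} {m. monad_hmap D m} {j. monad_vmap D j}"
  by (intro cofolded_endo_system.intro cofolded_endo_system_axioms.intro endo_system_Mnd)
    (simp_all add: cofolded_axioms monad_hmap_inherited_coholonomy)

end

section \<open>The forgetful double functor\<close>

lemma forget_sel:
  "hsrc (forget_hmap m) = endo.truncate (hsrc m)" "htgt (forget_hmap m) = endo.truncate (htgt m)"
  "hmor (forget_hmap m) = hmor m" "hcell (forget_hmap m) = hcell m"
  "vsrc (forget_vmap j) = endo.truncate (vsrc j)" "vtgt (forget_vmap j) = endo.truncate (vtgt j)"
  "vmor (forget_vmap j) = vmor j" "vsqr (forget_vmap j) = vsqr j"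
  "base (endo.truncate M) = base M" "emor (endo.truncate M) = emor M"
  by (simp_all add: forget_hmap_def forget_vmap_def endo.truncate_def)

text \<open>Identities, composites and coholonomies of maps draw on no more of a monad than
  \<open>base\<close> and \<open>emor\<close>, which truncation keeps.\<close>

lemma forget_maps:
  "forget_hmap (hmap_id D M) = hmap_id D (endo.truncate M)"
  "forget_hmap (hmap_comp D m n) = hmap_comp D (forget_hmap m) (forget_hmap n)"
  "forget_vmap (vmap_id D M) = vmap_id D (endo.truncate M)"
  "forget_vmap (vmap_comp D j k) = vmap_comp D (forget_vmap j) (forget_vmap k)"
  "forget_hmap (inherited_coholonomy \<Lambda> j) = inherited_coholonomy \<Lambda> (forget_vmap j)"
  by (simp_all add: forget_hmap_def forget_vmap_def hmap_id_def hmap_comp_def vmap_id_def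
      vmap_comp_def inherited_coholonomy_def endo.truncate_def)

lemma forget_endo:
  "endomorphism D (endo.truncate M) \<longleftrightarrow> endomorphism D M"
  "endo_hmap D (forget_hmap m) \<longleftrightarrow> endo_hmap D m"
  "endo_vmap D (forget_vmap j) \<longleftrightarrow> endo_vmap D j"
  by (simp_all add: endomorphism_def endo_hmap_def endo_vmap_def forget_sel)

lemma (in dblcat) double_functor_forgetful: "double_functor (Mnd D) (End D) forgetful"
proof -
  interpret E: endo_system D "{E. endomorphism D E}" "{m. endo_hmap D m}" "{j. endo_vmap D j}"
    by (rule endo_system_End)
  interpret M: endo_system D "{M. is_monad D M}" "{m. monad_hmap D m}" "{j. monad_vmap D j}"
    by (rule endo_system_Mnd)
  have sqr: "Fsqr forgetful s \<in> Sqr (End D)" if "s \<in> Sqr (Mnd D)" for s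
    using that M.EE_SqrD[OF that[unfolded Mnd_def]] unfolding End_def Mnd_def E.EE_Sqr M.EE_Sqr
    by (simp add: forgetful_def forget_endo monad_hmap monad_vmap endo_square_def forget_sel)
  note simps = forgetful_def forget_endo forget_maps forget_sel monad_hmap monad_vmap monad(1)
  have "functor_between (hor_cat (Mnd D)) (hor_cat (End D)) (Fobj forgetful) (Fhor forgetful)"
    unfolding Mnd_def End_def
    by (rule functor_betweenI[OF M.EE_categories(1) E.EE_categories(1)];
        simp add: double_cat_defs E.EE_simps M.EE_simps simps)
  moreover have "functor_between (ver_cat (Mnd D)) (ver_cat (End D)) (Fobj forgetful) (Fver forgetful)"
    unfolding Mnd_def End_def
    by (rule functor_betweenI[OF M.EE_categories(2) E.EE_categories(2)];
        simp add: double_cat_defs E.EE_simps M.EE_simps simps)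
  moreover have "functor_between (sqr_hcat (Mnd D)) (sqr_hcat (End D)) (Fver forgetful) (Fsqr forgetful)"
    using sqr unfolding Mnd_def End_def
    by (intro functor_betweenI[OF M.EE_categories(3) E.EE_categories(3)];
        simp add: double_cat_defs E.EE_simps M.EE_simps simps)
  moreover have "functor_between (sqr_vcat (Mnd D)) (sqr_vcat (End D)) (Fhor forgetful) (Fsqr forgetful)"
    using sqr unfolding Mnd_def End_def
    by (intro functor_betweenI[OF M.EE_categories(4) E.EE_categories(4)];
        simp add: double_cat_defs E.EE_simps M.EE_simps simps)
  ultimately show ?thesis
    using M.double_category_EE E.double_category_EE by (simp add: double_functor_def Mnd_def End_def)
qed

text \<open>Both inherited cofoldings are given by the same formulas in data that
  \<open>forgetful\<close> leaves alone, so once \<open>forgetful\<close> is a double functor,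
  compatibility is a direct computation.\<close>

lemma (in dblcat) forgetful_preserves_cofoldings:
  "preserves_cofoldings (Mnd D) (inherited_cofolding D \<Lambda>) (End D) (inherited_cofolding D \<Lambda>) forgetful"
  unfolding preserves_cofoldings_def using double_functor_forgetful
  by (simp add: forgetful_def inherited_cofolding_def Let_def forget_maps forget_sel)

theorem proposition7p2:
  fixes D :: "('o, 'h, 'v, 's) dblcat"
    and \<Lambda> :: "('o, 'h, 'v, 's) cofolding_data"
  assumes "double_category D"
    and "cofolding D \<Lambda>"
  shows "cofolding (End D) (inherited_cofolding D \<Lambda>) \<and>
         cofolding (Mnd D) (inherited_cofolding D \<Lambda>) \<and>
         preserves_cofoldings (Mnd D) (inherited_cofolding D \<Lambda>)
           (End D) (inherited_cofolding D \<Lambda>) forgetful"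
proof -
  interpret cofolded D \<Lambda>
    using assms by (simp add: cofolded_def dblcat_def cofolded_axioms_def)
  show ?thesis
    using cofolded_endo_system.cofolding_EE[OF cofolded_End]
      cofolded_endo_system.cofolding_EE[OF cofolded_Mnd] forgetful_preserves_cofoldings
    by (simp add: End_def Mnd_def)
qed

end
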